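(* Let $\psi:N^2\to\mathbb{R}^3:(u,v)\mapsto(u,v,f(u,v))$ be an improper affine sphere with affine normal $(0,0,1)$. Let $\gamma=(\gamma_1,\gamma_2):I\to\mathbb{R}^2$ be a curve such that $$F(t,u,v)=(\gamma_1(t)u,\ \gamma_1(t)v,\ \gamma_1(t)f(u,v)+\gamma_2(t),\ \gamma_1(t))$$ defines a positive definite affine hypersurface of $\mathbb{R}^4$. Then $F$ admits a pointwise $Z_3$- or $SO(2)$-symmetry.
   Context: A nondegenerate affine hypersurface $F:M^3\to\mathbb{R}^4$ is an immersion with (equi)affine (Blaschke) normal field $\xi$, inducing $\nabla$, $h$, $S$ by $D_XY=\nabla_XY+h(X,Y)\xi$, $D_X\xi=-SX$ ($D$ the flat connection of $\mathbb{R}^4$), where $h$ (affine metric) is nondegenerate and $|\det(X_1,X_2,X_3,\xi)|=1$ for $h$-orthonormal $X_1,X_2,X_3$; $S$ is the affine shape operator. The difference tensor is $K(X,Y)=\nabla_XY-\widehat\nabla_XY$ ($\widehat\nabla$ the Levi-Civita connection of $h$). Positive definite means $h$ is positive definite. An improper affine sphere in $\mathbb{R}^3$ is a nondegenerate affine surface whose affine normal is constant. Here $I\subset\mathbb{R}$ is an interval. $F$ admits a pointwise $G$-symmetry ($G=Z_3$ or $SO(2)$) if at every point $p$ there is a subgroup of the orientation-preserving linear isometries of $(T_pM,h)$, consisting of the rotations about some axis by multiples of $2\pi/3$ (for $Z_3$) or by all angles (for $SO(2)$), each element $g$ of which satisfies $K(gX,gY)=gK(X,Y)$ and $S(gX)=gS(X)$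 for all $X,Y\in T_pM$. *)

theory Defs
  imports "HOL-Analysis.Analysis" "HOL-Algebra.Group"
begin

section \<open>Smooth maps\<close>

primrec C_k_on ::
    "nat \<Rightarrow> 'a::real_normed_vector set \<Rightarrow> ('a \<Rightarrow> 'b::real_normed_vector) \<Rightarrow> bool" where
  "C_k_on 0 U f \<longleftrightarrow> continuous_on U f"
| "C_k_on (Suc k) U f \<longleftrightarrow> (\<forall>p\<in>U. f differentiable (at p)) \<and>
     (\<forall>v. C_k_on k U (\<lambda>p. frechet_derivative f (at p) v))"

text \<open>Only meant for open \<open>U\<close> in a finite-dimensional space.\<close>

definition smooth_on ::
    "'a::real_normed_vector set \<Rightarrow> ('a \<Rightarrow> 'b::real_normed_vector) \<Rightarrow> bool" where
  "smooth_on U f \<longleftrightarrow> (\<forall>k. C_k_on k U f)"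


section \<open>Affine hypersurfaces in a global chart\<close>

text \<open>
  The manifold is an open set \<open>U\<close> of \<open>real^'n\<close>, all of whose tangent spaces are identified
  with \<open>real^'n\<close>; vector fields on \<open>U\<close>, and vector fields along \<open>F\<close>, are functions of the point.
  A function used as a vector field on \<open>U\<close> only matters through its values on \<open>U\<close>.
\<close>

type_synonym 'n vfield = "real^'n \<Rightarrow> real^'n"

text \<open>The directional derivative; for vector fields \<open>V\<close> along an immersion into \<open>real^'m\<close>
  this is the flat connection \<open>D\<close>.\<close>

definition dir_deriv ::
    "(real^'n \<Rightarrow> 'b::real_normed_vector) \<Rightarrow> real^'n \<Rightarrow> real^'n \<Rightarrow> 'b" where
  "dir_deriv V p x = frechet_derivative V (at p) x"

definition immersion_on :: "(real^'n) set \<Rightarrow> (real^'n \<Rightarrow> real^'m) \<Rightarrow> bool" where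
  "immersion_on U F \<longleftrightarrow> open U \<and> smooth_on U F \<and> (\<forall>p\<in>U. inj (dir_deriv F p))"

definition transversal_on ::
    "(real^'n) set \<Rightarrow> (real^'n \<Rightarrow> real^'m) \<Rightarrow> (real^'n \<Rightarrow> real^'m) \<Rightarrow> bool" where
  "transversal_on U F \<xi> \<longleftrightarrow> smooth_on U \<xi> \<and> (\<forall>p\<in>U. \<xi> p \<notin> range (dir_deriv F p))"

text \<open>
  For an immersed hypersurface with transversal field \<open>\<xi>\<close>, every \<open>w\<close> is uniquely
  \<open>F\<^sub>* z + c \<xi>\<close> at \<open>p\<close>; the next two functions return \<open>z\<close> and \<open>c\<close>.
\<close>

definition tangential_part ::
    "(real^'n \<Rightarrow> real^'m) \<Rightarrow> (real^'n \<Rightarrow> real^'m) \<Rightarrow> real^'n \<Rightarrow> real^'m \<Rightarrow> real^'n" where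
  "tangential_part F \<xi> p w = (THE z. \<exists>c. w = dir_deriv F p z + c *\<^sub>R \<xi> p)"

definition transversal_part ::
    "(real^'n \<Rightarrow> real^'m) \<Rightarrow> (real^'n \<Rightarrow> real^'m) \<Rightarrow> real^'n \<Rightarrow> real^'m \<Rightarrow> real" where
  "transversal_part F \<xi> p w = (THE c. \<exists>z. w = dir_deriv F p z + c *\<^sub>R \<xi> p)"

text \<open>\<open>D\<^sub>X Y = \<nabla>\<^sub>X Y + h(X,Y) \<xi>\<close> defines \<open>\<nabla>\<close> and \<open>h\<close>. The latter is tensorial, so tangent vectors
  are extended to constant fields.\<close>

definition induced_connection ::
    "(real^'n \<Rightarrow> real^'m) \<Rightarrow> (real^'n \<Rightarrow> real^'m) \<Rightarrow> 'n vfield \<Rightarrow> 'n vfield \<Rightarrow> 'n vfield" where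
  "induced_connection F \<xi> X Y =
     (\<lambda>p. tangential_part F \<xi> p (dir_deriv (\<lambda>q. dir_deriv F q (Y q)) p (X p)))"

definition affine_metric ::
    "(real^'n \<Rightarrow> real^'m) \<Rightarrow> (real^'n \<Rightarrow> real^'m) \<Rightarrow> real^'n \<Rightarrow> real^'n \<Rightarrow> real^'n \<Rightarrow> real" where
  "affine_metric F \<xi> p x y = transversal_part F \<xi> p (dir_deriv (\<lambda>q. dir_deriv F q y) p x)"

text \<open>\<open>D\<^sub>X \<xi> = - S X\<close>\<close>

definition shape_operator ::
    "(real^'n \<Rightarrow> real^'m) \<Rightarrow> (real^'n \<Rightarrow> real^'m) \<Rightarrow> real^'n \<Rightarrow> real^'n \<Rightarrow> real^'n" where
  "shape_operator F \<xi> p x = - tangential_part F \<xi> p (dir_deriv \<xi> p x)"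

text \<open>Orthonormality for possibly indefinite forms: squares of the basis vectors are \<open>1\<close> or \<open>-1\<close>.\<close>

definition orthonormal_list :: "(real^'n \<Rightarrow> real^'n \<Rightarrow> real) \<Rightarrow> (real^'n) list \<Rightarrow> bool" where
  "orthonormal_list b xs \<longleftrightarrow> (\<forall>i<length xs. \<forall>j<length xs.
     \<bar>b (xs ! i) (xs ! j)\<bar> = (if i = j then 1 else 0))"

text \<open>The index type \<open>'m\<close> of the ambient space is meant to be a numeral type, so that
  \<open>vector\<close> forms the matrix whose rows are the listed vectors.\<close>

definition affine_normal ::
    "(real^'n) set \<Rightarrow> (real^'n \<Rightarrow> real^'m::{finite,one,plus}) \<Rightarrow>
       (real^'n \<Rightarrow> real^'m::{finite,one,plus}) \<Rightarrow> bool" where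
  "affine_normal U F \<xi> \<longleftrightarrow> transversal_on U F \<xi> \<and>
     (\<forall>p\<in>U. \<forall>x. dir_deriv \<xi> p x \<in> range (dir_deriv F p)) \<and>
     (\<forall>p\<in>U. \<forall>xs. length xs = CARD('n) \<and> orthonormal_list (affine_metric F \<xi> p) xs \<longrightarrow>
        \<bar>det (vector (map (dir_deriv F p) xs @ [\<xi> p]) :: real^'m::{finite,one,plus}^'m::{finite,one,plus})\<bar> = 1)"

definition affine_hypersurface ::
    "(real^'n) set \<Rightarrow> (real^'n \<Rightarrow> real^'m::{finite,one,plus}) \<Rightarrow>
       (real^'n \<Rightarrow> real^'m::{finite,one,plus}) \<Rightarrow> bool" where
  "affine_hypersurface U F \<xi> \<longleftrightarrow> CARD('m::{finite,one,plus}) = CARD('n) + 1 \<and> immersion_on U F \<and>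
     affine_normal U F \<xi> \<and>
     (\<forall>p\<in>U. \<forall>x. (\<forall>y. affine_metric F \<xi> p x y = 0) \<longrightarrow> x = 0)"

definition positive_definite_on ::
    "(real^'n) set \<Rightarrow> (real^'n \<Rightarrow> real^'n \<Rightarrow> real^'n \<Rightarrow> real) \<Rightarrow> bool" where
  "positive_definite_on U h \<longleftrightarrow> (\<forall>p\<in>U. \<forall>x. x \<noteq> 0 \<longrightarrow> h p x x > 0)"

definition improper_affine_sphere ::
    "(real^2) set \<Rightarrow> (real^2 \<Rightarrow> real^3) \<Rightarrow> (real^2 \<Rightarrow> real^3) \<Rightarrow> bool" where
  "improper_affine_sphere U F \<xi> \<longleftrightarrow> affine_hypersurface U F \<xi> \<and> (\<exists>c. \<forall>p\<in>U. \<xi> p = c)"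


section \<open>Levi-Civita connection and difference tensor\<close>

definition affine_connection ::
    "(real^'n) set \<Rightarrow> ('n vfield \<Rightarrow> 'n vfield \<Rightarrow> 'n vfield) \<Rightarrow> bool" where
  "affine_connection U nab \<longleftrightarrow>
     (\<forall>X Y. smooth_on U X \<and> smooth_on U Y \<longrightarrow> smooth_on U (nab X Y)) \<and>
     (\<forall>X X' Y. smooth_on U X \<and> smooth_on U X' \<and> smooth_on U Y \<longrightarrow>
        (\<forall>p\<in>U. nab (\<lambda>q. X q + X' q) Y p = nab X Y p + nab X' Y p)) \<and>
     (\<forall>\<phi> X Y. smooth_on U \<phi> \<and> smooth_on U X \<and> smooth_on U Y \<longrightarrow>
        (\<forall>p\<in>U. nab (\<lambda>q. \<phi> q *\<^sub>R X q) Y p = \<phi> p *\<^sub>R nab X Y p)) \<and>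
     (\<forall>X Y Y'. smooth_on U X \<and> smooth_on U Y \<and> smooth_on U Y' \<longrightarrow>
        (\<forall>p\<in>U. nab X (\<lambda>q. Y q + Y' q) p = nab X Y p + nab X Y' p)) \<and>
     (\<forall>\<phi> X Y. smooth_on U \<phi> \<and> smooth_on U X \<and> smooth_on U Y \<longrightarrow>
        (\<forall>p\<in>U. nab X (\<lambda>q. \<phi> q *\<^sub>R Y q) p =
           dir_deriv \<phi> p (X p) *\<^sub>R Y p + \<phi> p *\<^sub>R nab X Y p))"

definition lie_bracket :: "'n::finite vfield \<Rightarrow> 'n vfield \<Rightarrow> 'n vfield" where
  "lie_bracket X Y = (\<lambda>p. dir_deriv Y p (X p) - dir_deriv X p (Y p))"

definition is_levi_civita ::
    "(real^'n) set \<Rightarrow> (real^'n \<Rightarrow> real^'n \<Rightarrow> real^'n \<Rightarrow> real) \<Rightarrow>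
       ('n vfield \<Rightarrow> 'n vfield \<Rightarrow> 'n vfield) \<Rightarrow> bool" where
  "is_levi_civita U h nab \<longleftrightarrow> affine_connection U nab \<and>
     (\<forall>X Y. smooth_on U X \<and> smooth_on U Y \<longrightarrow>
        (\<forall>p\<in>U. nab X Y p - nab Y X p = lie_bracket X Y p)) \<and>
     (\<forall>X Y Z. smooth_on U X \<and> smooth_on U Y \<and> smooth_on U Z \<longrightarrow>
        (\<forall>p\<in>U. dir_deriv (\<lambda>q. h q (Y q) (Z q)) p (X p) =
           h p (nab X Y p) (Z p) + h p (Y p) (nab X Z p)))"

text \<open>For a smooth pseudo-Riemannian metric \<open>h\<close> on an open \<open>U\<close> such a connection exists, and its
  values on \<open>U\<close> at smooth fields are unique. Elsewhere nothing is determined, whence \<open>SOME\<close>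
  rather than \<open>THE\<close>.\<close>

definition levi_civita ::
    "(real^'n) set \<Rightarrow> (real^'n \<Rightarrow> real^'n \<Rightarrow> real^'n \<Rightarrow> real) \<Rightarrow>
       'n vfield \<Rightarrow> 'n vfield \<Rightarrow> 'n vfield" where
  "levi_civita U h = (SOME nab. is_levi_civita U h nab)"

text \<open>\<open>K\<close> is tensorial, so tangent vectors are extended to constant fields.\<close>

definition difference_tensor ::
    "(real^'n) set \<Rightarrow> (real^'n \<Rightarrow> real^'m) \<Rightarrow> (real^'n \<Rightarrow> real^'m) \<Rightarrow>
       real^'n \<Rightarrow> real^'n \<Rightarrow> real^'n \<Rightarrow> real^'n" where
  "difference_tensor U F \<xi> p x y =
     induced_connection F \<xi> (\<lambda>_. x) (\<lambda>_. y) p -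
     levi_civita U (affine_metric F \<xi>) (\<lambda>_. x) (\<lambda>_. y) p"


section \<open>Pointwise symmetries\<close>

definition special_isometries :: "(real^'n \<Rightarrow> real^'n \<Rightarrow> real) \<Rightarrow> (real^'n \<Rightarrow> real^'n) monoid" where
  "special_isometries b =
     \<lparr>carrier = {g. linear g \<and> (\<forall>x y. b (g x) (g y) = b x y) \<and> det (matrix g) > 0},
      mult = (\<circ>), one = id\<rparr>"

text \<open>For a basis \<open>a, u, v\<close> that is orthonormal with respect to the positive definite form \<open>b\<close>:
  rotation by \<open>\<theta>\<close> about the axis spanned by \<open>a\<close>.\<close>

definition rotation ::
    "(real^3 \<Rightarrow> real^3 \<Rightarrow> real) \<Rightarrow> real^3 \<Rightarrow> real^3 \<Rightarrow> real^3 \<Rightarrow> real \<Rightarrow> real^3 \<Rightarrow> real^3" where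
  "rotation b a u v \<theta> x =
     b x a *\<^sub>R a + b x u *\<^sub>R (cos \<theta> *\<^sub>R u + sin \<theta> *\<^sub>R v) + b x v *\<^sub>R (cos \<theta> *\<^sub>R v - sin \<theta> *\<^sub>R u)"

text \<open>\<open>A\<close> is the set of admissible rotation angles.\<close>

definition pointwise_symmetry ::
    "real set \<Rightarrow> (real^3) set \<Rightarrow> (real^3 \<Rightarrow> real^4) \<Rightarrow> (real^3 \<Rightarrow> real^4) \<Rightarrow> bool" where
  "pointwise_symmetry A U F \<xi> \<longleftrightarrow> (\<forall>p\<in>U. \<exists>G.
     subgroup G (special_isometries (affine_metric F \<xi> p)) \<and>
     (\<exists>a u v. orthonormal_list (affine_metric F \<xi> p) [a, u, v] \<and>
        G = rotation (affine_metric F \<xi> p) a u v ` A) \<and>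
     (\<forall>g\<in>G.
        (\<forall>x y. difference_tensor U F \<xi> p (g x) (g y) = g (difference_tensor U F \<xi> p x y)) \<and>
        (\<forall>x. shape_operator F \<xi> p (g x) = g (shape_operator F \<xi> p x))))"

definition pointwise_Z3_symmetry ::
    "(real^3) set \<Rightarrow> (real^3 \<Rightarrow> real^4) \<Rightarrow> (real^3 \<Rightarrow> real^4) \<Rightarrow> bool" where
  "pointwise_Z3_symmetry = pointwise_symmetry {of_int k * (2 * pi / 3) |k::int. True}"

definition pointwise_SO2_symmetry ::
    "(real^3) set \<Rightarrow> (real^3 \<Rightarrow> real^4) \<Rightarrow> (real^3 \<Rightarrow> real^4) \<Rightarrow> bool" where
  "pointwise_SO2_symmetry = pointwise_symmetry UNIV"

end

theory Submission
  imports Defs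
begin

text \<open>
  Write \<open>a = \<gamma>\<^sub>1\<close>, \<open>b = \<gamma>\<^sub>2\<close>, \<open>\<lambda> = b'' - a'' b' / a'\<close>, and let \<open>g\<close> be the Hessian of \<open>f\<close>, whose
  determinant is \<open>1\<close> because \<open>\<psi>\<close> is an improper affine sphere. The constant field
  \<open>e\<^sub>3 = (0,0,1,0)\<close> is transversal to \<open>F\<close>. If \<open>\<phi>\<close> is the \<open>e\<^sub>3\<close>-component of the affine normal \<open>\<xi>\<close>,
  the affine metric is \<open>h = (\<lambda> dt\<^sup>2 + a g) / \<phi>\<close> and the volume condition on \<open>\<xi>\<close> reads
  \<open>\<phi>\<^sup>5 a\<^sup>2 a'\<^sup>2 = \<lambda>\<close>. Hence \<open>\<phi>\<close> depends on \<open>t\<close> only, and since \<open>D \<xi>\<close> is tangential, \<open>\<xi> - \<phi> e\<^sub>3\<close> is a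
  multiple of \<open>\<partial>\<^sub>t F\<close> by a function of \<open>t\<close>. So \<open>S\<close> is a multiple of the identity on the plane
  orthogonal to \<open>\<partial>\<^sub>t\<close> and has \<open>\<partial>\<^sub>t\<close> as an eigenvector. By the Koszul formula for the warped product
  metric \<open>h = A(t) dt\<^sup>2 + B(t) g\<close>, the trilinear form \<open>h(K(x,y),z)\<close> is the sum of terms built
  from \<open>dt\<close> and \<open>h\<close>, which are invariant under all rotations about \<open>\<partial>\<^sub>t\<close>, and of \<open>- B/2\<close> times the
  third derivative of \<open>f\<close>. The latter is trace free, as one sees by differentiating \<open>det g = 1\<close>, and a
  trace-free cubic form on the plane is invariant under rotations of order three. Thus a
  \<open>Z\<^sub>3\<close>-symmetry always exists.
\<close>

section \<open>Smooth maps\<close>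

text \<open>Having a given derivative at an interior point is a local property, so both sides choose
  from the same set of candidates. The equality therefore covers points where no derivative
  exists.\<close>

lemma frechet_derivative_cong_open:
  assumes "open U" "p \<in> U" "\<And>q. q \<in> U \<Longrightarrow> f q = g q"
  shows "frechet_derivative f (at p) = frechet_derivative g (at p)"
proof -
  have "(f has_derivative D) (at p) \<longleftrightarrow> (g has_derivative D) (at p)" for D
    using assms has_derivative_transform_within_open[of _ D p UNIV U] by (metis (no_types, lifting))
  then show ?thesis
    by (simp add: frechet_derivative_def)
qed

section \<open>Closure properties of maps of class C^k\<close>

lemma C_k_on_cong:
  assumes "open U" "\<And>p. p \<in> U \<Longrightarrow> f p = g p"
  shows "C_k_on k U f \<longleftrightarrow> C_k_on k U g"
  using assms(2)
proof (induction k arbitrary: f g)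
  case 0
  then show ?case by (simp cong: continuous_on_cong)
next
  case (Suc k)
  have 1: "frechet_derivative f (at p) = frechet_derivative g (at p)" if "p \<in> U" for p
    using that Suc.prems by (intro frechet_derivative_cong_open[OF assms(1)]) auto
  have 2: "f differentiable (at p) \<longleftrightarrow> g differentiable (at p)" if "p \<in> U" for p
    unfolding differentiable_def
    using that Suc.prems assms(1) has_derivative_transform_within_open[of _ _ p UNIV U]
    by (metis (no_types, lifting))
  have "C_k_on k U (\<lambda>p. frechet_derivative f (at p) v) \<longleftrightarrow>
      C_k_on k U (\<lambda>p. frechet_derivative g (at p) v)" for v
    by (rule Suc.IH) (simp add: 1)
  then show ?case by (simp add: 2)
qed

text \<open>The recursion speaks of the chosen \<open>frechet_derivative\<close>; uniqueness of
  derivatives lets an explicit \<open>f'\<close> take its place on \<open>U\<close>. Most inductions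
  below go through this rule.\<close>

lemma C_k_on_Suc_intro:
  assumes "open U" and f': "\<And>p. p \<in> U \<Longrightarrow> (f has_derivative f' p) (at p)"
    and "\<And>v. C_k_on k U (\<lambda>p. f' p v)"
  shows "C_k_on (Suc k) U f"
proof -
  have "frechet_derivative f (at p) = f' p" if "p \<in> U" for p
    using frechet_derivative_at[OF f'[OF that]] by simp
  then have "C_k_on k U (\<lambda>p. frechet_derivative f (at p) v) \<longleftrightarrow> C_k_on k U (\<lambda>p. f' p v)" for v
    using assms(1) by (intro C_k_on_cong) auto
  then show ?thesis
    using assms by (auto simp: differentiable_def)
qed

lemma C_k_on_Suc_imp: "C_k_on (Suc k) U f \<Longrightarrow> C_k_on k U f"
proof (induction k arbitrary: f)
  case 0
  then show ?case
    by (auto intro!: continuous_at_imp_continuous_on differentiable_imp_continuous_within)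
next
  case (Suc k)
  have "\<forall>v. C_k_on k U (\<lambda>p. frechet_derivative f (at p) v)"
    using Suc.prems Suc.IH by (metis C_k_on.simps(2))
  with Suc.prems show ?case by simp
qed

lemma C_k_on_has_derivative:
  "C_k_on (Suc k) U f \<Longrightarrow> p \<in> U \<Longrightarrow> (f has_derivative frechet_derivative f (at p)) (at p)"
  by (simp add: frechet_derivative_works)

lemma C_k_on_const: "C_k_on k U (\<lambda>_. c)"
  by (induction k arbitrary: c) (simp_all add: frechet_derivative_const)

lemma C_k_on_add:
  assumes "open U" "C_k_on k U f" "C_k_on k U g"
  shows "C_k_on k U (\<lambda>p. f p + g p)"
  using assms(2,3)
proof (induction k arbitrary: f g)
  case 0
  then show ?case by (simp add: continuous_on_add)
next
  case (Suc k)
  show ?case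
    by (rule C_k_on_Suc_intro[OF assms(1)
          has_derivative_add[OF C_k_on_has_derivative[OF Suc.prems(1)] C_k_on_has_derivative[OF Suc.prems(2)]]])
       (use Suc assms(1) in auto)
qed

lemma C_k_on_bounded_linear:
  assumes "open U" "bounded_linear L" "C_k_on k U f"
  shows "C_k_on k U (\<lambda>p. L (f p))"
  using assms(3)
proof (induction k arbitrary: f)
  case 0
  then show ?case by (simp add: bounded_linear.continuous_on[OF assms(2)])
next
  case (Suc k)
  show ?case
    by (rule C_k_on_Suc_intro[OF assms(1)
          bounded_linear.has_derivative[OF assms(2) C_k_on_has_derivative[OF Suc.prems]]])
       (use Suc assms(1) in auto)
qed

text \<open>The Leibniz rule gives two bilinear terms, each with one undifferentiated factor, which
  \<open>C_k_on_Suc_imp\<close> lowers from class k+1 to class k.\<close>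

lemma C_k_on_bilinear:
  assumes "open U" "bounded_bilinear B" "C_k_on k U f" "C_k_on k U g"
  shows "C_k_on k U (\<lambda>p. B (f p) (g p))"
  using assms(3,4)
proof (induction k arbitrary: f g)
  case 0
  then show ?case by (simp add: bounded_bilinear.continuous_on[OF assms(2)])
next
  case (Suc k)
  show ?case
  proof (rule C_k_on_Suc_intro[OF assms(1) bounded_bilinear.FDERIV[OF assms(2)
          C_k_on_has_derivative[OF Suc.prems(1)] C_k_on_has_derivative[OF Suc.prems(2)]]])
    fix v
    show "C_k_on k U (\<lambda>p. B (f p) (frechet_derivative g (at p) v) + B (frechet_derivative f (at p) v) (g p))"
      using Suc.prems C_k_on_Suc_imp[OF Suc.prems(1)] C_k_on_Suc_imp[OF Suc.prems(2)]
      by (intro C_k_on_add[OF assms(1)] Suc.IH) auto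
  qed (use assms(1) in auto)
qed

text \<open>The derivative -(1/f) f' (1/f) contains 1/f itself, which is of class k by the induction
  hypothesis; hence the induction runs with \<open>f\<close> fixed.\<close>

lemma C_k_on_inverse:
  fixes f :: "'a::real_normed_vector \<Rightarrow> real"
  assumes "open U" "C_k_on k U f" "\<And>p. p \<in> U \<Longrightarrow> f p \<noteq> 0"
  shows "C_k_on k U (\<lambda>p. inverse (f p))"
  using assms(2)
proof (induction k)
  case 0
  then show ?case using assms(3) by (auto intro!: continuous_on_inverse)
next
  case (Suc k)
  note mult = C_k_on_bilinear[OF assms(1) bounded_bilinear_mult]
  note inv = Suc.IH[OF C_k_on_Suc_imp[OF Suc.prems]]
  show ?case
  proof (rule C_k_on_Suc_intro[OF assms(1) Deriv.has_derivative_inverse[OF _ C_k_on_has_derivative[OF Suc.prems]]])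
    fix v
    have "C_k_on k U (\<lambda>p. - (inverse (f p) * frechet_derivative f (at p) v * inverse (f p)))"
      using Suc.prems
      by (intro C_k_on_bounded_linear[OF assms(1) bounded_linear_minus[OF bounded_linear_ident]] mult inv) auto
    then show "C_k_on k U (\<lambda>p. - (inverse (f p) * frechet_derivative f (at p) v * inverse (f p)))" .
  qed (use assms in auto)
qed

text \<open>For an affine inner map the derivative in direction \<open>v\<close> is the derivative
  of \<open>f\<close> in the fixed direction \<open>L v\<close>, composed with the same map, so the
  induction over \<open>f\<close> closes.\<close>

lemma C_k_on_affine:
  assumes "open U" "open V" "bounded_linear L" "\<And>p. p \<in> V \<Longrightarrow> c + L p \<in> U" "C_k_on k U f"
  shows "C_k_on k V (\<lambda>p. f (c + L p))"
  using assms(5)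
proof (induction k arbitrary: f)
  case 0
  have "continuous_on V (\<lambda>p. c + L p)"
    using assms(3) by (intro continuous_intros linear_continuous_on) auto
  then show ?case
    using 0 assms(4) by (auto intro: continuous_on_compose2)
next
  case (Suc k)
  have "((\<lambda>p. c + L p) has_derivative L) (at p)" for p
    by (auto intro!: derivative_eq_intros bounded_linear_imp_has_derivative assms(3))
  then have "((\<lambda>p. f (c + L p)) has_derivative (\<lambda>v. frechet_derivative f (at (c + L p)) (L v))) (at p)"
    if "p \<in> V" for p
    using has_derivative_compose[OF _ C_k_on_has_derivative[OF Suc.prems]] assms(4)[OF that] by blast
  then show ?case
    by (rule C_k_on_Suc_intro[OF assms(2)])
       (use Suc assms(2) in auto)
qed

section \<open>Closure properties of smooth maps\<close>

lemma smooth_on_cong: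
  "open U \<Longrightarrow> (\<And>p. p \<in> U \<Longrightarrow> f p = g p) \<Longrightarrow> smooth_on U f \<longleftrightarrow> smooth_on U g"
  unfolding smooth_on_def using C_k_on_cong by blast

lemma smooth_on_const: "smooth_on U (\<lambda>_. c)"
  by (simp add: smooth_on_def C_k_on_const)

lemma smooth_on_add:
  "open U \<Longrightarrow> smooth_on U f \<Longrightarrow> smooth_on U g \<Longrightarrow> smooth_on U (\<lambda>p. f p + g p)"
  by (simp add: smooth_on_def C_k_on_add)

lemma smooth_on_bounded_linear:
  "open U \<Longrightarrow> bounded_linear L \<Longrightarrow> smooth_on U f \<Longrightarrow> smooth_on U (\<lambda>p. L (f p))"
  by (simp add: smooth_on_def C_k_on_bounded_linear)

lemma smooth_on_minus: "open U \<Longrightarrow> smooth_on U f \<Longrightarrow> smooth_on U (\<lambda>p. - f p)"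
  by (rule smooth_on_bounded_linear[OF _ bounded_linear_minus[OF bounded_linear_ident]])

lemma smooth_on_diff:
  "open U \<Longrightarrow> smooth_on U f \<Longrightarrow> smooth_on U g \<Longrightarrow> smooth_on U (\<lambda>p. f p - g p)"
  using smooth_on_add[of U f "\<lambda>p. - g p"] by (simp add: smooth_on_minus)

lemma smooth_on_mult:
  fixes f g :: "'a::real_normed_vector \<Rightarrow> real"
  shows "open U \<Longrightarrow> smooth_on U f \<Longrightarrow> smooth_on U g \<Longrightarrow> smooth_on U (\<lambda>p. f p * g p)"
  by (simp add: smooth_on_def C_k_on_bilinear[OF _ bounded_bilinear_mult])

lemma smooth_on_scaleR:
  "open U \<Longrightarrow> smooth_on U f \<Longrightarrow> smooth_on U g \<Longrightarrow> smooth_on U (\<lambda>p. f p *\<^sub>R g p)"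
  by (simp add: smooth_on_def C_k_on_bilinear[OF _ bounded_bilinear_scaleR])

lemma smooth_on_divide:
  fixes f g :: "'a::real_normed_vector \<Rightarrow> real"
  assumes "open U" "smooth_on U f" "smooth_on U g" "\<And>p. p \<in> U \<Longrightarrow> g p \<noteq> 0"
  shows "smooth_on U (\<lambda>p. f p / g p)"
  unfolding divide_inverse using assms
  by (intro smooth_on_mult) (auto simp: smooth_on_def C_k_on_inverse)

lemma smooth_on_sum:
  "open U \<Longrightarrow> (\<And>i. i \<in> S \<Longrightarrow> smooth_on U (f i)) \<Longrightarrow> smooth_on U (\<lambda>p. \<Sum>i\<in>S. f i p)"
  by (induction S rule: infinite_finite_induct) (auto intro: smooth_on_const smooth_on_add)

lemma smooth_on_affine:
  assumes "open U" "open V" "bounded_linear L" "\<And>p. p \<in> V \<Longrightarrow> c + L p \<in> U" "smooth_on U f"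
  shows "smooth_on V (\<lambda>p. f (c + L p))"
  using assms by (simp add: smooth_on_def C_k_on_affine)

lemma smooth_on_linear_comp:
  assumes "open U" "open V" "bounded_linear L" "\<And>p. p \<in> V \<Longrightarrow> L p \<in> U" "smooth_on U f"
  shows "smooth_on V (\<lambda>p. f (L p))"
  using smooth_on_affine[of U V L 0 f] assms by simp

lemma smooth_on_linear:
  assumes "open U" "bounded_linear L"
  shows "smooth_on U L"
proof -
  have "C_k_on k U L" for k
  proof (cases k)
    case (Suc j)
    then show ?thesis
      using C_k_on_Suc_intro[OF assms(1) bounded_linear_imp_has_derivative[OF assms(2)]]
      by (simp add: C_k_on_const assms(1))
  qed (simp add: linear_continuous_on assms)
  then show ?thesis by (simp add: smooth_on_def)
qed

lemma smooth_on_nth: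
  fixes f :: "'a::real_normed_vector \<Rightarrow> real^'n"
  shows "open U \<Longrightarrow> smooth_on U f \<Longrightarrow> smooth_on U (\<lambda>p. f p $ i)"
  by (rule smooth_on_bounded_linear[OF _ bounded_linear_vec_nth])

lemma smooth_on_vecI:
  fixes f :: "'a::real_normed_vector \<Rightarrow> real^'n"
  assumes "open U" "\<And>i. smooth_on U (\<lambda>p. f p $ i)"
  shows "smooth_on U f"
proof -
  have "f p = (\<Sum>i\<in>UNIV. f p $ i *\<^sub>R axis i 1)" for p
    by (simp add: vec_eq_iff axis_def if_distrib cong: if_cong)
  moreover have "smooth_on U (\<lambda>p. \<Sum>i\<in>UNIV. f p $ i *\<^sub>R (axis i 1 :: real^'n))"
    by (intro smooth_on_sum smooth_on_scaleR smooth_on_const assms)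
  ultimately show ?thesis
    using smooth_on_cong[OF assms(1)] by (metis (no_types, lifting))
qed

lemma smooth_on_has_derivative:
  "smooth_on U f \<Longrightarrow> p \<in> U \<Longrightarrow> (f has_derivative frechet_derivative f (at p)) (at p)"
  unfolding smooth_on_def by (metis C_k_on_has_derivative)

lemma smooth_on_frechet_derivative:
  "smooth_on U f \<Longrightarrow> smooth_on U (\<lambda>p. frechet_derivative f (at p) v)"
  unfolding smooth_on_def by (metis C_k_on.simps(2))

lemma smooth_on_imp_continuous_on: "smooth_on U f \<Longrightarrow> continuous_on U f"
  unfolding smooth_on_def by (metis C_k_on.simps(1))

lemma frechet_derivative_linear:
  "smooth_on U f \<Longrightarrow> p \<in> U \<Longrightarrow> linear (frechet_derivative f (at p))"
  using smooth_on_has_derivative has_derivative_linear by blast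

lemma has_derivative_vecI:
  fixes f :: "'a::real_normed_vector \<Rightarrow> real^'n"
  assumes "\<And>i. ((\<lambda>x. f x $ i) has_derivative (\<lambda>x. f' x $ i)) (at p)"
  shows "(f has_derivative f') (at p)"
  using assms unfolding has_derivative_componentwise_within[of f]
  by (auto simp: Basis_vec_def inner_axis)

section \<open>Symmetry of second derivatives\<close>

text \<open>Two mean value steps: along \<open>v\<close> for the difference of \<open>f\<close> in
  direction \<open>w\<close>, then along \<open>w\<close> for the derivative of \<open>f\<close> in
  direction \<open>v\<close>. The second difference is symmetric in \<open>v\<close> and
  \<open>w\<close>, which is what makes the mixed derivatives comparable.\<close>

lemma second_difference_mvt:
  fixes f :: "'a::real_normed_vector \<Rightarrow> real"
  assumes f: "smooth_on U f" and r: "0 < r"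
    and U: "\<And>s t. 0 \<le> s \<Longrightarrow> s \<le> r \<Longrightarrow> 0 \<le> t \<Longrightarrow> t \<le> r \<Longrightarrow> p + s *\<^sub>R v + t *\<^sub>R w \<in> U"
  obtains s t where "0 < s" "s < r" "0 < t" "t < r"
    "f (p + r *\<^sub>R v + r *\<^sub>R w) - f (p + r *\<^sub>R v) - f (p + r *\<^sub>R w) + f p =
      r * r * frechet_derivative (\<lambda>q. frechet_derivative f (at q) v) (at (p + s *\<^sub>R v + t *\<^sub>R w)) w"
proof -
  have D1: "((\<lambda>s. g (p + s *\<^sub>R v + t *\<^sub>R w)) has_real_derivative frechet_derivative g (at (p + s *\<^sub>R v + t *\<^sub>R w)) v) (at s)"
    and D2: "((\<lambda>t. g (p + s *\<^sub>R v + t *\<^sub>R w)) has_real_derivative frechet_derivative g (at (p + s *\<^sub>R v + t *\<^sub>R w)) w) (at t)"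
    if "smooth_on U g" "0 \<le> s" "s \<le> r" "0 \<le> t" "t \<le> r" for g :: "'a \<Rightarrow> real" and s t
  proof -
    note G = smooth_on_has_derivative[OF that(1) U[OF that(2-)]]
    have lin: "linear (frechet_derivative g (at (p + s *\<^sub>R v + t *\<^sub>R w)))"
      using G has_derivative_linear by blast
    show "((\<lambda>s. g (p + s *\<^sub>R v + t *\<^sub>R w)) has_real_derivative frechet_derivative g (at (p + s *\<^sub>R v + t *\<^sub>R w)) v) (at s)"
      unfolding has_field_derivative_def
      by (rule has_derivative_eq_rhs[OF has_derivative_compose[where f = "\<lambda>s. p + s *\<^sub>R v + t *\<^sub>R w" and f' = "\<lambda>h. h *\<^sub>R v", OF _ G]])
        (auto intro!: derivative_eq_intros simp: linear_scale[OF lin] fun_eq_iff)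
    show "((\<lambda>t. g (p + s *\<^sub>R v + t *\<^sub>R w)) has_real_derivative frechet_derivative g (at (p + s *\<^sub>R v + t *\<^sub>R w)) w) (at t)"
      unfolding has_field_derivative_def
      by (rule has_derivative_eq_rhs[OF has_derivative_compose[where f = "\<lambda>t. p + s *\<^sub>R v + t *\<^sub>R w" and f' = "\<lambda>h. h *\<^sub>R w", OF _ G]])
        (auto intro!: derivative_eq_intros simp: linear_scale[OF lin] fun_eq_iff)
  qed
  let ?g = "\<lambda>q. frechet_derivative f (at q) v"
  have g: "smooth_on U ?g" using f by (rule smooth_on_frechet_derivative)
  define d where "d s = f (p + s *\<^sub>R v + r *\<^sub>R w) - f (p + s *\<^sub>R v + 0 *\<^sub>R w)" for s
  have "\<exists>s>0. s < r \<and> d r - d 0 = (r - 0) * (?g (p + s *\<^sub>R v + r *\<^sub>R w) - ?g (p + s *\<^sub>R v + 0 *\<^sub>R w))"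
    unfolding d_def using r by (intro MVT2 DERIV_diff D1[OF f]) auto
  then obtain s where s: "0 < s" "s < r"
    "d r - d 0 = r * (?g (p + s *\<^sub>R v + r *\<^sub>R w) - ?g (p + s *\<^sub>R v + 0 *\<^sub>R w))" by auto
  have "\<exists>t>0. t < r \<and> ?g (p + s *\<^sub>R v + r *\<^sub>R w) - ?g (p + s *\<^sub>R v + 0 *\<^sub>R w) =
      (r - 0) * frechet_derivative ?g (at (p + s *\<^sub>R v + t *\<^sub>R w)) w"
    using r s by (intro MVT2 D2[OF g]) auto
  then obtain t where t: "0 < t" "t < r" "?g (p + s *\<^sub>R v + r *\<^sub>R w) - ?g (p + s *\<^sub>R v + 0 *\<^sub>R w) =
      r * frechet_derivative ?g (at (p + s *\<^sub>R v + t *\<^sub>R w)) w" by auto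
  show ?thesis
    by (rule that[OF s(1,2) t(1,2)]) (use s(3) t(3) in \<open>simp add: d_def algebra_simps\<close>)
qed

text \<open>Schwarz's theorem. In a small parallelogram at \<open>p\<close> both mixed derivatives
  take, at some point each, the value of the same second difference divided by the square of
  \<open>r\<close>. By continuity each stays within half of the supposed gap \<open>2 * e\<close> of
  its value at \<open>p\<close>, a contradiction.\<close>

lemma second_derivative_commute:
  fixes f :: "'a::real_normed_vector \<Rightarrow> real"
  assumes "open U" "smooth_on U f" "p \<in> U"
  shows "frechet_derivative (\<lambda>q. frechet_derivative f (at q) v) (at p) w =
    frechet_derivative (\<lambda>q. frechet_derivative f (at q) w) (at p) v"
proof (rule ccontr)
  let ?H = "\<lambda>v w q. frechet_derivative (\<lambda>q. frechet_derivative f (at q) v) (at q) w"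
  assume neq: "?H v w p \<noteq> ?H w v p"
  define e where "e = \<bar>?H v w p - ?H w v p\<bar> / 2"
  have e: "e > 0" using neq by (simp add: e_def)
  have near: "\<forall>\<^sub>F q in nhds p. q \<in> U \<and> \<bar>?H x y q - ?H x y p\<bar> < e" for x y
  proof -
    have "continuous_on U (?H x y)"
      by (intro smooth_on_imp_continuous_on smooth_on_frechet_derivative assms(2))
    then have "isCont (?H x y) p"
      using assms by (simp add: continuous_on_eq_continuous_at)
    then have "(?H x y \<longlongrightarrow> ?H x y p) (nhds p)"
      unfolding isCont_def by (rule tendsto_at_iff_tendsto_nhds[THEN iffD1])
    then have "\<forall>\<^sub>F q in nhds p. dist (?H x y q) (?H x y p) < e"
      by (rule tendstoD[OF _ e])
    moreover have "\<forall>\<^sub>F q in nhds p. q \<in> U"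
      using assms by (simp add: eventually_nhds_in_open)
    ultimately show ?thesis by eventually_elim (simp add: dist_real_def)
  qed
  obtain d where d: "d > 0" "\<And>q. dist q p < d \<Longrightarrow>
      q \<in> U \<and> \<bar>?H v w q - ?H v w p\<bar> < e \<and> \<bar>?H w v q - ?H w v p\<bar> < e"
    using eventually_conj[OF near[of v w] near[of w v]] unfolding eventually_nhds_metric by auto
  \<comment> \<open>The parallelogram with sides \<open>r v\<close> and \<open>r w\<close> then lies
    within distance d/2 of \<open>p\<close>; the summand 1 keeps the denominator positive if both
    vectors vanish.\<close>
  define r where "r = d / 2 / (norm v + norm w + 1)"
  have r: "r > 0" using d(1) by (simp add: r_def add_nonneg_pos)
  have small: "dist (p + s *\<^sub>R v + t *\<^sub>R w) p < d" if "0 \<le> s" "s \<le> r" "0 \<le> t" "t \<le> r" for s t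
  proof -
    have "dist (p + s *\<^sub>R v + t *\<^sub>R w) p = norm (s *\<^sub>R v + t *\<^sub>R w)"
      by (simp add: dist_norm)
    also have "\<dots> \<le> s * norm v + t * norm w"
      using norm_triangle_ineq[of "s *\<^sub>R v" "t *\<^sub>R w"] that by simp
    also have "\<dots> \<le> r * norm v + r * norm w"
      using that by (intro add_mono mult_right_mono) auto
    also have "\<dots> \<le> r * (norm v + norm w + 1)" using r by (simp add: algebra_simps)
    also have "\<dots> = d / 2"
    proof -
      have "norm v + norm w + 1 \<noteq> 0"
        using norm_ge_zero[of v] norm_ge_zero[of w] by linarith
      then show ?thesis using r_def by (metis nonzero_eq_divide_eq)
    qed
    finally show ?thesis using d(1) by simp
  qed
  obtain s t where st: "0 < s" "s < r" "0 < t" "t < r"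
    "f (p + r *\<^sub>R v + r *\<^sub>R w) - f (p + r *\<^sub>R v) - f (p + r *\<^sub>R w) + f p = r * r * ?H v w (p + s *\<^sub>R v + t *\<^sub>R w)"
    by (rule second_difference_mvt[OF assms(2) r, of p v w]) (use small d(2) in blast)+
  have small': "dist (p + s *\<^sub>R w + t *\<^sub>R v) p < d" if "0 \<le> s" "s \<le> r" "0 \<le> t" "t \<le> r" for s t
    using small[OF that(3,4,1,2)] by (simp add: algebra_simps)
  obtain s' t' where st': "0 < s'" "s' < r" "0 < t'" "t' < r"
    "f (p + r *\<^sub>R w + r *\<^sub>R v) - f (p + r *\<^sub>R w) - f (p + r *\<^sub>R v) + f p = r * r * ?H w v (p + s' *\<^sub>R w + t' *\<^sub>R v)"
    by (rule second_difference_mvt[OF assms(2) r, of p w v]) (use small' d(2) in blast)+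
  have "r * r * ?H v w (p + s *\<^sub>R v + t *\<^sub>R w) = r * r * ?H w v (p + s' *\<^sub>R w + t' *\<^sub>R v)"
    unfolding st(5)[symmetric] st'(5)[symmetric] by (simp add: add.commute add.left_commute)
  then have "?H v w (p + s *\<^sub>R v + t *\<^sub>R w) = ?H w v (p + s' *\<^sub>R w + t' *\<^sub>R v)"
    using r by simp
  moreover have "\<bar>?H v w (p + s *\<^sub>R v + t *\<^sub>R w) - ?H v w p\<bar> < e"
    using d(2) small st by simp
  moreover have "\<bar>?H w v (p + s' *\<^sub>R w + t' *\<^sub>R v) - ?H w v p\<bar> < e"
    using d(2) small' st' by simp
  ultimately show False unfolding e_def by argo
qed

section \<open>The Levi-Civita connection\<close>

definition symmetric_form :: "('a::real_vector \<Rightarrow> 'a \<Rightarrow> real) \<Rightarrow> bool" where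
  "symmetric_form b \<longleftrightarrow> (\<forall>x. linear (b x)) \<and> (\<forall>x y. b x y = b y x)"

lemma symmetric_formD:
  assumes "symmetric_form b"
  shows "b x y = b y x" "b (x + x') y = b x y + b x' y" "b x (y + y') = b x y + b x y'"
    "b (c *\<^sub>R x) y = c * b x y" "b x (c *\<^sub>R y) = c * b x y"
    "b (x - x') y = b x y - b x' y" "b x (y - y') = b x y - b x y'"
    "b (- x) y = - b x y" "b x (- y) = - b x y"
    "b 0 y = 0" "b x 0 = 0"
proof -
  have lin: "linear (b x)" and sym: "b x y = b y x" for x y
    using assms by (auto simp: symmetric_form_def)
  show "b x y = b y x" by (rule sym)
  show r: "b x (y + y') = b x y + b x y'" "b x (c *\<^sub>R y) = c * b x y" "b x (y - y') = b x y - b x y'"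
    "b x (- y) = - b x y" "b x 0 = 0" for x y y' c
    using lin by (simp_all add: linear_add linear_scale linear_diff linear_neg linear_0)
  show "b (x + x') y = b x y + b x' y" "b (c *\<^sub>R x) y = c * b x y" "b (x - x') y = b x y - b x' y"
    "b (- x) y = - b x y" "b 0 y = 0"
    unfolding sym[of _ y] by (rule r)+
qed

lemma bilinear_coordinates:
  fixes B :: "real^'n \<Rightarrow> real^'n \<Rightarrow> 'b::real_vector"
  assumes "bilinear B"
  shows "B x y = (\<Sum>i\<in>UNIV. \<Sum>j\<in>UNIV. (x $ i * y $ j) *\<^sub>R B (axis i 1) (axis j 1))"
proof -
  have e: "v = (\<Sum>i\<in>UNIV. v $ i *\<^sub>R axis i 1)" for v :: "real^'n"
    by (simp add: vec_eq_iff axis_def if_distrib cong: if_cong)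
  have "B x y = B (\<Sum>i\<in>UNIV. x $ i *\<^sub>R axis i 1) (\<Sum>i\<in>UNIV. y $ i *\<^sub>R axis i 1)"
    using e[of x] e[of y] by simp
  then show ?thesis
    using assms by (simp add: bilinear_sum bilinear_lmul bilinear_rmul sum.cartesian_product)
qed

lemma symmetric_form_bilinear: "symmetric_form b \<Longrightarrow> bilinear b"
  unfolding bilinear_def by (auto intro!: linearI simp: symmetric_formD(2-5))

lemma frechet_derivative_coordinates:
  assumes "smooth_on U Y" "p \<in> U"
  shows "frechet_derivative Y (at p) (x::real^'n) =
    (\<Sum>i\<in>UNIV. x $ i *\<^sub>R frechet_derivative Y (at p) (axis i 1))"
proof -
  have e: "x = (\<Sum>i\<in>UNIV. x $ i *\<^sub>R axis i 1)"
    by (simp add: vec_eq_iff axis_def if_distrib cong: if_cong)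
  have "linear (frechet_derivative Y (at p))"
    using assms by (rule frechet_derivative_linear)
  then have "frechet_derivative Y (at p) (\<Sum>i\<in>UNIV. x $ i *\<^sub>R axis i 1) =
      (\<Sum>i\<in>UNIV. x $ i *\<^sub>R frechet_derivative Y (at p) (axis i 1))"
    by (simp add: linear_sum linear_scale)
  then show ?thesis using e by simp
qed

text \<open>\<open>C_k_on\<close> differentiates in constant directions only; the varying direction
  \<open>X p\<close> is expanded over the axes.\<close>

lemma smooth_on_dir_deriv:
  assumes "open U" "smooth_on U X" "smooth_on U Y"
  shows "smooth_on U (\<lambda>p. dir_deriv Y p (X p))"
proof -
  have "smooth_on U (\<lambda>p. \<Sum>i\<in>UNIV. X p $ i *\<^sub>R frechet_derivative Y (at p) (axis i 1))"
    by (intro smooth_on_sum smooth_on_scaleR smooth_on_nth smooth_on_frechet_derivative assms)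
  then show ?thesis
    unfolding dir_deriv_def
    by (rule smooth_on_cong[THEN iffD1, OF assms(1), rotated])
      (use frechet_derivative_coordinates[OF assms(3)] in simp)
qed

text \<open>A Leibniz rule with three terms for a form that varies with the point. Smoothness of the
  form is known only for constant arguments, so everything is expanded in the finitely many
  coefficients \<open>B q (axis i 1) (axis j 1)\<close>.\<close>

lemma has_derivative_bilinear_field:
  fixes B :: "'a::real_normed_vector \<Rightarrow> real^'n \<Rightarrow> real^'n \<Rightarrow> real"
  assumes "open U" "p \<in> U"
    and bil: "\<And>q. q \<in> U \<Longrightarrow> bilinear (B q)" and smooth: "\<And>x y. smooth_on U (\<lambda>q. B q x y)"
    and Y: "(Y has_derivative Y') (at p)" and Z: "(Z has_derivative Z') (at p)"
  shows "((\<lambda>q. B q (Y q) (Z q)) has_derivative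
    (\<lambda>x. frechet_derivative (\<lambda>q. B q (Y p) (Z p)) (at p) x + B p (Y' x) (Z p) + B p (Y p) (Z' x))) (at p)"
proof -
  let ?b = "\<lambda>q i j. B q (axis i 1) (axis j 1)"
  let ?db = "\<lambda>i j. frechet_derivative (\<lambda>q. ?b q i j) (at p)"
  note b = smooth_on_has_derivative[OF smooth assms(2)]
  have nth: "((\<lambda>q. W q $ i) has_derivative (\<lambda>x. W' x $ i)) (at p)"
    if "(W has_derivative W') (at p)" for W W' :: "'a \<Rightarrow> real^'n" and i
    using bounded_linear.has_derivative[OF bounded_linear_vec_nth that] .
  have D: "((\<lambda>q. \<Sum>i\<in>UNIV. \<Sum>j\<in>UNIV. (Y q $ i * Z q $ j) *\<^sub>R ?b q i j) has_derivative
     (\<lambda>x. \<Sum>i\<in>UNIV. \<Sum>j\<in>UNIV. (Y p $ i * Z p $ j) *\<^sub>R ?db i j x + (Y' x $ i * Z p $ j) *\<^sub>R ?b p i j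
        + (Y p $ i * Z' x $ j) *\<^sub>R ?b p i j)) (at p)"
    if "(Y has_derivative Y') (at p)" "(Z has_derivative Z') (at p)" for Y Z Y' Z'
  proof -
    have T: "((\<lambda>q. (Y q $ i * Z q $ j) *\<^sub>R ?b q i j) has_derivative
        (\<lambda>x. (Y p $ i * Z p $ j) *\<^sub>R ?db i j x + (Y' x $ i * Z p $ j) *\<^sub>R ?b p i j
        + (Y p $ i * Z' x $ j) *\<^sub>R ?b p i j)) (at p)" for i j
      by (rule has_derivative_eq_rhs[OF has_derivative_scaleR[OF has_derivative_mult[OF nth[OF that(1)] nth[OF that(2)]] b]])
        (simp add: algebra_simps fun_eq_iff)
    show ?thesis by (rule has_derivative_sum, rule has_derivative_sum, rule T)
  qed
  have eq: "(\<Sum>i\<in>UNIV. \<Sum>j\<in>UNIV. (Y q $ i * Z q $ j) *\<^sub>R ?b q i j) = B q (Y q) (Z q)" if "q \<in> U" for q Y Z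
    by (rule bilinear_coordinates[OF bil[OF that], symmetric])
  have D': "((\<lambda>q. B q (Y q) (Z q)) has_derivative
     (\<lambda>x. \<Sum>i\<in>UNIV. \<Sum>j\<in>UNIV. (Y p $ i * Z p $ j) *\<^sub>R ?db i j x + (Y' x $ i * Z p $ j) *\<^sub>R ?b p i j
        + (Y p $ i * Z' x $ j) *\<^sub>R ?b p i j)) (at p)"
    if "(Y has_derivative Y') (at p)" "(Z has_derivative Z') (at p)" for Y Z Y' Z'
    by (rule has_derivative_transform_within_open[OF D[OF that] assms(1,2)]) (rule eq)
  \<comment> \<open>The coordinate formula applied to constant fields identifies its first sum as
    the derivative with frozen arguments.\<close>
  have const: "frechet_derivative (\<lambda>q. B q (Y p) (Z p)) (at p) =
      (\<lambda>x. \<Sum>i\<in>UNIV. \<Sum>j\<in>UNIV. (Y p $ i * Z p $ j) *\<^sub>R ?db i j x)"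
    using frechet_derivative_at[OF D'[OF has_derivative_const has_derivative_const]] by simp
  show ?thesis
    using D'[OF Y Z] unfolding const bilinear_coordinates[OF bil[OF assms(2)], of "Y' x" "Z p" for x]
      bilinear_coordinates[OF bil[OF assms(2)], of "Y p" "Z' x" for x]
    by (simp only: sum.distrib)
qed

lemma smooth_on_bilinear_field:
  fixes B :: "'a::real_normed_vector \<Rightarrow> real^'n \<Rightarrow> real^'n \<Rightarrow> 'b::real_normed_vector"
  assumes "open U" and bil: "\<And>q. q \<in> U \<Longrightarrow> bilinear (B q)" and smooth: "\<And>x y. smooth_on U (\<lambda>q. B q x y)"
    and "smooth_on U Y" "smooth_on U Z"
  shows "smooth_on U (\<lambda>q. B q (Y q) (Z q))"
proof -
  have "smooth_on U (\<lambda>q. \<Sum>i\<in>UNIV. \<Sum>j\<in>UNIV. (Y q $ i * Z q $ j) *\<^sub>R B q (axis i 1) (axis j 1))"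
    by (intro smooth_on_sum smooth_on_scaleR smooth_on_mult smooth_on_nth assms)
  then show ?thesis
    by (rule smooth_on_cong[THEN iffD1, OF assms(1), rotated])
      (rule bilinear_coordinates[OF bil, symmetric])
qed

text \<open>\<open>\<Gamma>\<close> are the Christoffel symbols of the connection with respect to the constant fields.\<close>

lemma is_levi_civitaI:
  fixes h :: "real^'n \<Rightarrow> real^'n \<Rightarrow> real^'n \<Rightarrow> real"
    and \<Gamma> :: "real^'n \<Rightarrow> real^'n \<Rightarrow> real^'n \<Rightarrow> real^'n"
  assumes U: "open U"
    and h: "\<And>p. p \<in> U \<Longrightarrow> symmetric_form (h p)" and smooth_h: "\<And>x y. smooth_on U (\<lambda>p. h p x y)"
    and bil: "\<And>p. p \<in> U \<Longrightarrow> bilinear (\<Gamma> p)" and sym: "\<And>p x y. p \<in> U \<Longrightarrow> \<Gamma> p x y = \<Gamma> p y x"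
    and smooth: "\<And>x y. smooth_on U (\<lambda>p. \<Gamma> p x y)"
    and metric: "\<And>p x y z. p \<in> U \<Longrightarrow> dir_deriv (\<lambda>q. h q y z) p x = h p (\<Gamma> p x y) z + h p y (\<Gamma> p x z)"
  shows "is_levi_civita U h (\<lambda>X Y p. dir_deriv Y p (X p) + \<Gamma> p (X p) (Y p))"
proof -
  note D = smooth_on_has_derivative
  note lin = frechet_derivative_linear
  \<comment> \<open>Facts 1 to 5 are the clauses of \<open>affine_connection\<close> in order, 6 is
    vanishing torsion and 7 compatibility with the metric.\<close>
  have 1: "smooth_on U (\<lambda>p. dir_deriv Y p (X p) + \<Gamma> p (X p) (Y p))"
    if "smooth_on U X" "smooth_on U Y" for X Y
    by (rule smooth_on_add[OF U smooth_on_dir_deriv[OF U that] smooth_on_bilinear_field[OF U bil smooth that]])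
  have 2: "dir_deriv Y p (X p + X' p) + \<Gamma> p (X p + X' p) (Y p) =
      dir_deriv Y p (X p) + \<Gamma> p (X p) (Y p) + (dir_deriv Y p (X' p) + \<Gamma> p (X' p) (Y p))"
    if "p \<in> U" "smooth_on U Y" for p X X' Y
    by (simp add: dir_deriv_def linear_add[OF lin[OF that(2,1)]] bilinear_ladd[OF bil[OF that(1)]])
  have 3: "dir_deriv Y p (\<phi> p *\<^sub>R X p) + \<Gamma> p (\<phi> p *\<^sub>R X p) (Y p) =
      \<phi> p *\<^sub>R (dir_deriv Y p (X p) + \<Gamma> p (X p) (Y p))"
    if "p \<in> U" "smooth_on U Y" for p X \<phi> Y
    by (simp add: dir_deriv_def linear_scale[OF lin[OF that(2,1)]] bilinear_lmul[OF bil[OF that(1)]] scaleR_add_right)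
  have 4: "dir_deriv (\<lambda>q. Y q + Y' q) p (X p) + \<Gamma> p (X p) (Y p + Y' p) =
      dir_deriv Y p (X p) + \<Gamma> p (X p) (Y p) + (dir_deriv Y' p (X p) + \<Gamma> p (X p) (Y' p))"
    if "p \<in> U" "smooth_on U Y" "smooth_on U Y'" for p X Y Y'
    using frechet_derivative_at[OF has_derivative_add[OF D[OF that(2,1)] D[OF that(3,1)]], symmetric]
    by (simp add: dir_deriv_def bilinear_radd[OF bil[OF that(1)]])
  have 5: "dir_deriv (\<lambda>q. \<phi> q *\<^sub>R Y q) p (X p) + \<Gamma> p (X p) (\<phi> p *\<^sub>R Y p) =
      dir_deriv \<phi> p (X p) *\<^sub>R Y p + \<phi> p *\<^sub>R (dir_deriv Y p (X p) + \<Gamma> p (X p) (Y p))"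
    if "p \<in> U" "smooth_on U \<phi>" "smooth_on U Y" for p X \<phi> Y
    using frechet_derivative_at[OF has_derivative_scaleR[OF D[OF that(2,1)] D[OF that(3,1)]], symmetric]
    by (simp add: dir_deriv_def bilinear_rmul[OF bil[OF that(1)]] scaleR_add_right)
  have 6: "dir_deriv Y p (X p) + \<Gamma> p (X p) (Y p) - (dir_deriv X p (Y p) + \<Gamma> p (Y p) (X p)) = lie_bracket X Y p"
    if "p \<in> U" for p X Y
    using sym[OF that, of "X p" "Y p"] by (simp add: lie_bracket_def)
  have 7: "dir_deriv (\<lambda>q. h q (Y q) (Z q)) p (X p) =
      h p (dir_deriv Y p (X p) + \<Gamma> p (X p) (Y p)) (Z p) + h p (Y p) (dir_deriv Z p (X p) + \<Gamma> p (X p) (Z p))"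
    if p: "p \<in> U" and "smooth_on U Y" "smooth_on U Z" for p X Y Z
  proof -
    have "frechet_derivative (\<lambda>q. h q (Y q) (Z q)) (at p) =
        (\<lambda>x. frechet_derivative (\<lambda>q. h q (Y p) (Z p)) (at p) x +
        h p (frechet_derivative Y (at p) x) (Z p) + h p (Y p) (frechet_derivative Z (at p) x))"
      by (rule frechet_derivative_at[OF has_derivative_bilinear_field[OF U p symmetric_form_bilinear[OF h] smooth_h
          D[OF that(2) p] D[OF that(3) p]], symmetric])
    then show ?thesis
      using metric[OF p, of "Y p" "Z p" "X p"]
      by (simp add: dir_deriv_def symmetric_formD(2,3)[OF h[OF p]])
  qed
  show ?thesis
    unfolding is_levi_civita_def affine_connection_def
    by (intro conjI allI impI ballI; (elim conjE)?; rule 1 2 3 4 5 6 7; assumption)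
qed

text \<open>The Koszul formula for constant fields, whose Lie brackets vanish: metric compatibility
  is added for the directions \<open>x\<close> and \<open>y\<close> and subtracted for
  \<open>z\<close>, and torsion-freeness cancels all terms but two equal ones.\<close>

lemma koszul:
  assumes lc: "is_levi_civita U h nab" and "p \<in> U" and h: "symmetric_form (h p)"
  shows "2 * h p (nab (\<lambda>_. x) (\<lambda>_. y) p) z =
    dir_deriv (\<lambda>q. h q y z) p x + dir_deriv (\<lambda>q. h q x z) p y - dir_deriv (\<lambda>q. h q x y) p z"
proof -
  have metric: "dir_deriv (\<lambda>q. h q y z) p x = h p (nab (\<lambda>_. x) (\<lambda>_. y) p) z + h p y (nab (\<lambda>_. x) (\<lambda>_. z) p)"
    for x y z
    using lc \<open>p \<in> U\<close> smooth_on_const unfolding is_levi_civita_def by blast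
  have "nab (\<lambda>_. x) (\<lambda>_. y) p - nab (\<lambda>_. y) (\<lambda>_. x) p = lie_bracket (\<lambda>_. x) (\<lambda>_. y) p" for x y
    using lc \<open>p \<in> U\<close> smooth_on_const unfolding is_levi_civita_def by blast
  then have torsion: "nab (\<lambda>_. x) (\<lambda>_. y) p = nab (\<lambda>_. y) (\<lambda>_. x) p" for x y
    by (simp add: lie_bracket_def dir_deriv_def frechet_derivative_const)
  define c where "c x y z = h p (nab (\<lambda>_. x) (\<lambda>_. y) p) z" for x y z
  have m: "dir_deriv (\<lambda>q. h q y z) p x = c x y z + c x z y" for x y z
    unfolding c_def metric[of y z x] using symmetric_formD(1)[OF h] by simp
  have t: "c x y z = c y x z" for x y z
    unfolding c_def using torsion by metis
  show ?thesis
    using m[of y z x] m[of x z y] m[of x y z] t[of y x z] t[of z x y] t[of z y x] by (simp add: c_def)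
qed

section \<open>Groups of rotations\<close>

text \<open>The basis property takes the form of an explicit expansion, so that all later arguments
  reduce to comparing the three coordinates \<open>b x a\<close>, \<open>b x u\<close>,
  \<open>b x v\<close>.\<close>

locale orthonormal_triple =
  fixes b :: "real^3 \<Rightarrow> real^3 \<Rightarrow> real" and a u v :: "real^3"
  assumes form: "symmetric_form b"
    and expand: "\<And>x. x = b x a *\<^sub>R a + b x u *\<^sub>R u + b x v *\<^sub>R v"
    and orthonormal: "b a a = 1" "b u u = 1" "b v v = 1" "b a u = 0" "b a v = 0" "b u v = 0"
begin

lemma orthonormal': "b u a = 0" "b v a = 0" "b v u = 0"
  using orthonormal symmetric_formD(1)[OF form] by metis+

lemmas form_simps = symmetric_formD(2-)[OF form]

lemma rotation_coordinates:
  "b (rotation b a u v \<theta> x) a = b x a"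
  "b (rotation b a u v \<theta> x) u = cos \<theta> * b x u - sin \<theta> * b x v"
  "b (rotation b a u v \<theta> x) v = sin \<theta> * b x u + cos \<theta> * b x v"
  by (simp_all add: rotation_def form_simps orthonormal orthonormal' algebra_simps)

lemma form_coordinates: "b x y = b x a * b y a + b x u * b y u + b x v * b y v"
  by (subst expand[of y]) (simp add: form_simps algebra_simps)

lemma coordinates_eqI: "b x a = b y a \<Longrightarrow> b x u = b y u \<Longrightarrow> b x v = b y v \<Longrightarrow> x = y"
  using expand[of x] expand[of y] by simp

lemma rotation_isometry: "b (rotation b a u v \<theta> x) (rotation b a u v \<theta> y) = b x y"
proof -
  have "(c * p - s * q) * (c * p' - s * q') + (s * p + c * q) * (s * p' + c * q') = p * p' + q * q'"
    if "s\<^sup>2 + c\<^sup>2 = 1" for c s p q p' q' :: real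
    using that by algebra
  note * = this[OF sin_cos_squared_add, of \<theta> "b x u" "b x v" "b y u" "b y v"]
  have "b (rotation b a u v \<theta> x) (rotation b a u v \<theta> y) = b x a * b y a + b x u * b y u + b x v * b y v"
    using * by (subst form_coordinates) (simp add: rotation_coordinates)
  also have "\<dots> = b x y" by (rule form_coordinates[symmetric])
  finally show ?thesis .
qed

lemma rotation_add: "rotation b a u v \<theta> \<circ> rotation b a u v \<eta> = rotation b a u v (\<theta> + \<eta>)"
  by (rule ext, rule coordinates_eqI) (simp_all add: rotation_coordinates cos_add sin_add algebra_simps)

lemma rotation_0: "rotation b a u v 0 = id"
  by (rule ext, rule coordinates_eqI) (simp_all add: rotation_coordinates)

lemma rotation_linear: "linear (rotation b a u v \<theta>)"
  unfolding rotation_def by (rule linearI) (simp_all add: form_simps algebra_simps)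

text \<open>A rotation is the square of the rotation by half the angle, so its determinant is a
  square; the opposite rotation inverts it, so the determinant is not zero.\<close>

lemma det_rotation_pos: "det (matrix (rotation b a u v \<theta>)) > 0"
proof -
  have mult: "det (matrix (rotation b a u v (\<theta> + \<eta>))) =
      det (matrix (rotation b a u v \<theta>)) * det (matrix (rotation b a u v \<eta>))" for \<theta> \<eta>
    by (simp flip: rotation_add add: matrix_compose rotation_linear det_mul)
  have "det (matrix (rotation b a u v \<theta>)) * det (matrix (rotation b a u v (- \<theta>))) = 1"
    using mult[of \<theta> "- \<theta>"] by (simp add: rotation_0 matrix_id_mat_1)
  then have "det (matrix (rotation b a u v \<theta>)) \<noteq> 0" by auto
  moreover have "det (matrix (rotation b a u v \<theta>)) = (det (matrix (rotation b a u v (\<theta> / 2))))\<^sup>2"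
    using mult[of "\<theta> / 2" "\<theta> / 2"] by (simp add: power2_eq_square)
  ultimately show ?thesis by (simp add: less_le)
qed

lemma rotation_carrier: "rotation b a u v \<theta> \<in> carrier (special_isometries b)"
  by (simp add: special_isometries_def rotation_linear rotation_isometry det_rotation_pos)

text \<open>Angles act additively under composition, so a set of angles closed under sums and
  negation yields a subgroup. The monoid laws give uniqueness of inverses, which identifies
  \<open>inv\<close> with the rotation by the opposite angle.\<close>

lemma rotations_subgroup:
  assumes "0 \<in> A" "\<And>\<theta> \<eta>. \<theta> \<in> A \<Longrightarrow> \<eta> \<in> A \<Longrightarrow> \<theta> + \<eta> \<in> A" "\<And>\<theta>. \<theta> \<in> A \<Longrightarrow> - \<theta> \<in> A"
  shows "subgroup (rotation b a u v ` A) (special_isometries b)"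
proof -
  have mon: "Group.monoid (special_isometries b)"
  proof (rule monoidI)
    fix f g assume "f \<in> carrier (special_isometries b)" "g \<in> carrier (special_isometries b)"
    then show "f \<otimes>\<^bsub>special_isometries b\<^esub> g \<in> carrier (special_isometries b)"
      by (auto simp: special_isometries_def matrix_compose det_mul intro: linear_compose)
  qed (auto simp: special_isometries_def o_assoc linear_id id_def[symmetric] matrix_id_mat_1)
  show ?thesis
  proof (rule subgroup.intro)
    show "\<one>\<^bsub>special_isometries b\<^esub> \<in> rotation b a u v ` A"
      using rotation_0 assms(1) by (auto simp: special_isometries_def image_iff intro!: bexI[of _ 0])
    fix f assume "f \<in> rotation b a u v ` A"
    then obtain \<theta> where \<theta>: "f = rotation b a u v \<theta>" "\<theta> \<in> A" by auto
    have "rotation b a u v (- \<theta>) = inv\<^bsub>special_isometries b\<^esub> (rotation b a u v \<theta>)"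
      by (rule monoid.inv_unique'[OF mon rotation_carrier rotation_carrier])
        (simp_all add: special_isometries_def rotation_add rotation_0)
    then show "inv\<^bsub>special_isometries b\<^esub> f \<in> rotation b a u v ` A"
      using assms(3)[OF \<theta>(2)] by (metis \<theta>(1) imageI)
    fix g assume "g \<in> rotation b a u v ` A"
    then obtain \<eta> where "g = rotation b a u v \<eta>" "\<eta> \<in> A" by auto
    then show "f \<otimes>\<^bsub>special_isometries b\<^esub> g \<in> rotation b a u v ` A"
      using \<theta> assms(2) by (simp add: special_isometries_def rotation_add)
  qed (auto simp: rotation_carrier)
qed

lemma rotation_surj: "\<exists>w. rotation b a u v \<theta> w = z"
proof -
  have "(rotation b a u v \<theta> \<circ> rotation b a u v (- \<theta>)) z = z"
    by (simp add: rotation_add rotation_0)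
  then show ?thesis by auto
qed

text \<open>Pairing with all vectors turns equivariance of \<open>K\<close> into invariance of a
  trilinear form; surjectivity of the rotation lets the test vector be rotated as well.\<close>

lemma rotation_equivariantI:
  assumes "\<And>x y z. b (K (rotation b a u v \<theta> x) (rotation b a u v \<theta> y)) (rotation b a u v \<theta> z) = b (K x y) z"
  shows "K (rotation b a u v \<theta> x) (rotation b a u v \<theta> y) = rotation b a u v \<theta> (K x y)"
proof -
  let ?R = "rotation b a u v \<theta>"
  have "b (K (?R x) (?R y)) z = b (?R (K x y)) z" for z
  proof -
    obtain w where "z = ?R w" using rotation_surj by metis
    then show ?thesis by (simp add: assms rotation_isometry)
  qed
  then show ?thesis by (blast intro: coordinates_eqI)
qed

lemma orthonormal_list: "orthonormal_list b [a, u, v]"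
  by (simp add: orthonormal_list_def less_Suc_eq all_conj_distrib orthonormal orthonormal' imp_conjL)

end

section \<open>Hessian metrics\<close>

definition hess :: "('a::real_normed_vector \<Rightarrow> real) \<Rightarrow> 'a \<Rightarrow> 'a \<Rightarrow> 'a \<Rightarrow> real" where
  "hess f q x y = frechet_derivative (\<lambda>q. frechet_derivative f (at q) x) (at q) y"

definition cubic :: "('a::real_normed_vector \<Rightarrow> real) \<Rightarrow> 'a \<Rightarrow> 'a \<Rightarrow> 'a \<Rightarrow> 'a \<Rightarrow> real" where
  "cubic f q x y z = frechet_derivative (\<lambda>q. hess f q x y) (at q) z"

lemma smooth_on_hess: "smooth_on U f \<Longrightarrow> smooth_on U (\<lambda>q. hess f q x y)"
  unfolding hess_def by (intro smooth_on_frechet_derivative)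

lemma smooth_on_cubic: "smooth_on U f \<Longrightarrow> smooth_on U (\<lambda>q. cubic f q x y z)"
  unfolding cubic_def by (intro smooth_on_frechet_derivative smooth_on_hess)

lemma hess_symmetric_form:
  assumes "open U" "smooth_on U f" "q \<in> U"
  shows "symmetric_form (hess f q)"
  unfolding symmetric_form_def hess_def
  using second_derivative_commute[OF assms] frechet_derivative_linear[OF smooth_on_frechet_derivative[OF assms(2)] assms(3)]
  by blast

lemma cubic_commute12:
  assumes "open U" "smooth_on U f" "q \<in> U"
  shows "cubic f q x y z = cubic f q y x z"
proof -
  have "frechet_derivative (\<lambda>q. hess f q x y) (at q) = frechet_derivative (\<lambda>q. hess f q y x) (at q)"
    by (rule frechet_derivative_cong_open[OF assms(1,3)])
      (rule symmetric_formD(1)[OF hess_symmetric_form[OF assms(1,2)]])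
  then show ?thesis by (simp add: cubic_def)
qed

text \<open>Unfolded, \<open>cubic f q x\<close> is the Hessian of the derivative of
  \<open>f\<close> along \<open>x\<close>, so Schwarz's theorem applies again. Together with
  \<open>cubic_commute12\<close> the third derivative is totally symmetric.\<close>

lemma cubic_symmetric_form:
  assumes "open U" "smooth_on U f" "q \<in> U"
  shows "symmetric_form (cubic f q x)"
  using hess_symmetric_form[OF assms(1) smooth_on_frechet_derivative[OF assms(2), of x] assms(3)]
  unfolding cubic_def[abs_def] hess_def[abs_def] .

lemma has_derivative_hess:
  "smooth_on U f \<Longrightarrow> q \<in> U \<Longrightarrow> ((\<lambda>q. hess f q x y) has_derivative cubic f q x y) (at q)"
  using smooth_on_has_derivative[OF smooth_on_hess, of U f q x y] by (simp add: cubic_def[abs_def])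

lemma cubic_simps:
  assumes "open U" "smooth_on U f" "q \<in> U"
  shows "cubic f q (c *\<^sub>R x) y z = c * cubic f q x y z" "cubic f q x (c *\<^sub>R y) z = c * cubic f q x y z"
    "cubic f q x y (c *\<^sub>R z) = c * cubic f q x y z"
    "cubic f q (x + x') y z = cubic f q x y z + cubic f q x' y z"
    "cubic f q x (y + y') z = cubic f q x y z + cubic f q x y' z"
    "cubic f q x y (z + z') = cubic f q x y z + cubic f q x y z'"
  using symmetric_formD(2-5)[OF cubic_symmetric_form[OF assms]] cubic_commute12[OF assms] by metis+

lemma vec2_eq: "(x::real^2) = x $ 1 *\<^sub>R axis 1 1 + x $ 2 *\<^sub>R axis 2 1"
  by (simp add: vec_eq_iff forall_2 axis_def)

lemma hess_coordinates:
  fixes f :: "real^2 \<Rightarrow> real"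
  assumes "open U" "smooth_on U f" "q \<in> U"
  shows "hess f q x y = x $ 1 * y $ 1 * hess f q (axis 1 1) (axis 1 1)
    + (x $ 1 * y $ 2 + x $ 2 * y $ 1) * hess f q (axis 1 1) (axis 2 1)
    + x $ 2 * y $ 2 * hess f q (axis 2 1) (axis 2 1)"
  using symmetric_formD(1)[OF hess_symmetric_form[OF assms], of "axis 2 1" "axis 1 1"]
  by (subst vec2_eq[of x], subst vec2_eq[of y])
    (simp add: symmetric_formD(2-5)[OF hess_symmetric_form[OF assms]] algebra_simps)

definition hess_det :: "(real^2 \<Rightarrow> real) \<Rightarrow> real^2 \<Rightarrow> real" where
  "hess_det f q = hess f q (axis 1 1) (axis 1 1) * hess f q (axis 2 1) (axis 2 1) - (hess f q (axis 1 1) (axis 2 1))\<^sup>2"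

text \<open>The derivative of a determinant is the trace of the adjugate times the derivative of the
  matrix. Constancy thus says that the third derivative has no trace with respect to the
  Hessian.\<close>

lemma hess_det_const_derivative:
  assumes "open U" "smooth_on U f" "q \<in> U" "\<And>q. q \<in> U \<Longrightarrow> hess_det f q = c"
  shows "hess f q (axis 2 1) (axis 2 1) * cubic f q (axis 1 1) (axis 1 1) z
    - 2 * hess f q (axis 1 1) (axis 2 1) * cubic f q (axis 1 1) (axis 2 1) z
    + hess f q (axis 1 1) (axis 1 1) * cubic f q (axis 2 1) (axis 2 1) z = 0"
proof -
  note D = has_derivative_hess[OF assms(2,3)]
  have "(hess_det f has_derivative (\<lambda>z. hess f q (axis 1 1) (axis 1 1) * cubic f q (axis 2 1) (axis 2 1) z
      + cubic f q (axis 1 1) (axis 1 1) z * hess f q (axis 2 1) (axis 2 1)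
      - 2 * cubic f q (axis 1 1) (axis 2 1) z * hess f q (axis 1 1) (axis 2 1))) (at q)"
    unfolding hess_det_def[abs_def]
    by (auto intro!: derivative_eq_intros D simp: algebra_simps fun_eq_iff)
  moreover have "(hess_det f has_derivative (\<lambda>z. 0)) (at q)"
    by (rule has_derivative_transform_within_open[OF has_derivative_const[of c] assms(1,3)])
      (simp add: assms(4))
  ultimately have "(\<lambda>z. hess f q (axis 1 1) (axis 1 1) * cubic f q (axis 2 1) (axis 2 1) z
      + cubic f q (axis 1 1) (axis 1 1) z * hess f q (axis 2 1) (axis 2 1)
      - 2 * cubic f q (axis 1 1) (axis 2 1) z * hess f q (axis 1 1) (axis 2 1)) = (\<lambda>z. 0)"
    by (rule has_derivative_unique)
  from fun_cong[OF this, of z] show ?thesis by (simp add: algebra_simps)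
qed

section \<open>Orthonormal bases and trace-free cubic forms in the plane\<close>

text \<open>The frame is (r, 0), (s, w). The first three equations are its orthonormality; the last
  three say that the outer products of the two vectors sum to the inverse matrix, that is, the
  adjugate divided by the determinant.\<close>

lemma gram_schmidt_2:
  fixes G11 G12 G22 :: real
  assumes "G11 > 0" and d: "G11 * G22 - G12\<^sup>2 > 0"
  obtains r s w where "r\<^sup>2 * G11 = 1" "s * G11 + w * G12 = 0" "s\<^sup>2 * G11 + 2 * s * w * G12 + w\<^sup>2 * G22 = 1"
    "(r\<^sup>2 + s\<^sup>2) * (G11 * G22 - G12\<^sup>2) = G22" "s * w * (G11 * G22 - G12\<^sup>2) = - G12"
    "w\<^sup>2 * (G11 * G22 - G12\<^sup>2) = G11"
proof -
  define r where "r = 1 / sqrt G11"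
  define w where "w = sqrt (G11 / (G11 * G22 - G12\<^sup>2))"
  define s where "s = - G12 * w / G11"
  have r: "r\<^sup>2 * G11 = 1" using assms by (simp add: r_def power_divide)
  have w: "w\<^sup>2 * (G11 * G22 - G12\<^sup>2) = G11" using assms by (simp add: w_def)
  have s: "s * G11 + w * G12 = 0" using assms by (simp add: s_def)
  \<comment> \<open>After multiplication by \<open>G11\<close> the claims become polynomial
    consequences of \<open>r\<close>, \<open>s\<close> and \<open>w\<close>.\<close>
  have cancel: "x = y" if "G11 * x = G11 * y" for x y using that assms by simp
  have 1: "s * w * (G11 * G22 - G12\<^sup>2) = - G12"
    by (rule cancel) (use s w in algebra)
  have 2: "s\<^sup>2 * G11 + 2 * s * w * G12 + w\<^sup>2 * G22 = 1"
    by (rule cancel) (use s w in algebra)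
  have 3: "(r\<^sup>2 + s\<^sup>2) * (G11 * G22 - G12\<^sup>2) = G22"
    by (rule cancel, rule cancel) (use s w r in algebra)
  show ?thesis by (rule that[OF r s 2 3 1 w])
qed

text \<open>A cubic form on the plane whose trace vanishes is the real part of \<open>\<alpha> X Y Z\<close> in the
  complex coordinate of an orthonormal basis, hence invariant under rotations of order three.\<close>

lemma apolar_cubic_rotation:
  fixes C :: "'a::real_vector \<Rightarrow> 'a \<Rightarrow> 'a \<Rightarrow> real"
  assumes lin: "\<And>x y z c. C (c *\<^sub>R x) y z = c * C x y z" "\<And>x y z c. C x (c *\<^sub>R y) z = c * C x y z"
      "\<And>x y z c. C x y (c *\<^sub>R z) = c * C x y z"
      "\<And>x x' y z. C (x + x') y z = C x y z + C x' y z"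
      "\<And>x y y' z. C x (y + y') z = C x y z + C x y' z"
      "\<And>x y z z'. C x y (z + z') = C x y z + C x y z'"
    and sym: "\<And>x y z. C x y z = C y x z" "\<And>x y z. C x y z = C x z y"
    and trace: "\<And>z. C u u z + C v v z = 0"
    and rot: "cis \<theta> ^ 3 = 1"
    and c: "c = cos \<theta>" and s: "s = sin \<theta>"
  shows "C ((c * x1 - s * x2) *\<^sub>R u + (s * x1 + c * x2) *\<^sub>R v) ((c * y1 - s * y2) *\<^sub>R u + (s * y1 + c * y2) *\<^sub>R v)
      ((c * z1 - s * z2) *\<^sub>R u + (s * z1 + c * z2) *\<^sub>R v) =
    C (x1 *\<^sub>R u + x2 *\<^sub>R v) (y1 *\<^sub>R u + y2 *\<^sub>R v) (z1 *\<^sub>R u + z2 *\<^sub>R v)"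
proof -
  \<comment> \<open>With the trace gone, \<open>C u u u\<close> and \<open>C u u v\<close> determine
    the form.\<close>
  have t: "C v v u = - C u u u" "C v v v = - C u u v"
    using trace[of u] trace[of v] by auto
  have p: "C u v u = C u u v" "C v u u = C u u v" "C u v v = C v v u" "C v u v = C v v u"
    using sym by metis+
  \<comment> \<open>This is the real part of \<alpha> X Y Z with \<alpha> = \<open>C u u u\<close> -
    i \<open>C u u v\<close>.\<close>
  have form: "C (x1 *\<^sub>R u + x2 *\<^sub>R v) (y1 *\<^sub>R u + y2 *\<^sub>R v) (z1 *\<^sub>R u + z2 *\<^sub>R v) =
      C u u u * Re (Complex x1 x2 * Complex y1 y2 * Complex z1 z2) +
      C u u v * Im (Complex x1 x2 * Complex y1 y2 * Complex z1 z2)" for x1 x2 y1 y2 z1 z2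
    by (simp add: lin p t algebra_simps)
  \<comment> \<open>Rotating a vector multiplies its complex coordinate by
    \<open>cis \<theta>\<close>, so three arguments together contribute the cube, which is
    1.\<close>
  have cis: "Complex (c * x1 - s * x2) (s * x1 + c * x2) = cis \<theta> * Complex x1 x2" for x1 x2
    by (simp add: complex_eq_iff c s)
  have "cis \<theta> * X * (cis \<theta> * Y) * (cis \<theta> * Z) = X * Y * Z" for X Y Z
    using rot by (metis (no_types, opaque_lifting) mult.assoc mult.commute mult_1 power3_eq_cube)
  then show ?thesis by (simp only: form cis)
qed

section \<open>Charts of the form I x N\<close>

definition plane :: "real^3 \<Rightarrow> real^2" where
  "plane x = vector [x $ 2, x $ 3]"

lemma plane_nth [simp]: "plane x $ 1 = x $ 2" "plane x $ 2 = x $ 3"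
  by (simp_all add: plane_def)

lemma plane_simps: "plane (x + y) = plane x + plane y" "plane (c *\<^sub>R x) = c *\<^sub>R plane x"
  by (simp_all add: vec_eq_iff forall_2)

lemma bounded_linear_plane: "bounded_linear plane"
  by (intro linear_linear[THEN iffD2] linearI) (simp_all add: plane_simps)

locale product_chart =
  fixes I :: "real set" and N :: "(real^2) set" and M :: "(real^3) set"
  assumes openI: "open I" and openN: "open N" and openM: "open M"
    and M_eq: "M = {p. p $ 1 \<in> I \<and> plane p \<in> N}"
begin

lemma M_I: "p \<in> M \<Longrightarrow> p $ 1 \<in> I" and M_N: "p \<in> M \<Longrightarrow> plane p \<in> N"
  by (simp_all add: M_eq)

lemma smooth_t: "smooth_on I c \<Longrightarrow> smooth_on M (\<lambda>p. c (p $ 1))"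
  by (rule smooth_on_linear_comp[OF openI openM bounded_linear_vec_nth]) (auto simp: M_I)

lemma smooth_q: "smooth_on N g \<Longrightarrow> smooth_on M (\<lambda>p. g (plane p))"
  by (rule smooth_on_linear_comp[OF openN openM bounded_linear_plane]) (auto simp: M_N)

lemma has_derivative_t:
  assumes "smooth_on I c" "p \<in> M"
  shows "((\<lambda>p. c (p $ 1)) has_derivative (\<lambda>x. frechet_derivative c (at (p $ 1)) 1 * x $ 1)) (at p)"
proof -
  note D = smooth_on_has_derivative[OF assms(1) M_I[OF assms(2)]]
  have "frechet_derivative c (at (p $ 1)) x = frechet_derivative c (at (p $ 1)) 1 * x" for x
    using linear_scale[OF frechet_derivative_linear[OF assms(1) M_I[OF assms(2)]], of x 1] by simp
  then have "(\<lambda>x::real^3. frechet_derivative c (at (p $ 1)) (x $ 1)) = (\<lambda>x. frechet_derivative c (at (p $ 1)) 1 * x $ 1)"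
    by blast
  with has_derivative_compose[OF bounded_linear_imp_has_derivative[OF bounded_linear_vec_nth[of 1]] D]
  show ?thesis by (simp only:)
qed

lemma has_derivative_q:
  assumes "smooth_on N g" "p \<in> M"
  shows "((\<lambda>p. g (plane p)) has_derivative (\<lambda>x. frechet_derivative g (at (plane p)) (plane x))) (at p)"
  by (rule has_derivative_compose[OF bounded_linear_imp_has_derivative[OF bounded_linear_plane]
      smooth_on_has_derivative[OF assms(1) M_N[OF assms(2)]]])

end

section \<open>The warped metric A(t) dt^2 + B(t) g and its Levi-Civita connection\<close>

text \<open>The sign of \<open>B\<close> is left open because the Hessian may be negative definite.
  Positivity of \<open>B\<close> times its first diagonal entry, with determinant 1, makes B g
  positive definite.\<close>

locale warped_hessian = product_chart I N M
  for I :: "real set" and N :: "(real^2) set" and M :: "(real^3) set" +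
  fixes f :: "real^2 \<Rightarrow> real" and A B :: "real \<Rightarrow> real"
    and H :: "real^3 \<Rightarrow> real^3 \<Rightarrow> real^3 \<Rightarrow> real"
  assumes f: "smooth_on N f" and A: "smooth_on I A" and B: "smooth_on I B"
    and A_pos: "\<And>t. t \<in> I \<Longrightarrow> A t > 0"
    and B_pos: "\<And>t q. t \<in> I \<Longrightarrow> q \<in> N \<Longrightarrow> B t * hess f q (axis 1 1) (axis 1 1) > 0"
    and det1: "\<And>q. q \<in> N \<Longrightarrow> hess_det f q = 1"
    and H: "\<And>p x y. p \<in> M \<Longrightarrow> H p x y = A (p $ 1) * x $ 1 * y $ 1 + B (p $ 1) * hess f (plane p) (plane x) (plane y)"
begin

lemma B_nz: "p \<in> M \<Longrightarrow> B (p $ 1) \<noteq> 0"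
  using B_pos[OF M_I M_N] by force

lemmas hess_form = hess_symmetric_form[OF openN f M_N]

lemma H_form:
  assumes p: "p \<in> M"
  shows "symmetric_form (H p)"
proof -
  note form = symmetric_formD[OF hess_form[OF p]]
  have "H p x y = H p y x" for x y
    using form(1)[of "plane x" "plane y"] by (simp add: H[OF p])
  moreover have "linear (H p x)" for x
    by (rule linearI) (simp_all add: H[OF p] plane_simps form(3,5) algebra_simps)
  ultimately show ?thesis by (simp add: symmetric_form_def)
qed

abbreviation A' where "A' t \<equiv> frechet_derivative A (at t) 1"
abbreviation B' where "B' t \<equiv> frechet_derivative B (at t) 1"

lemma dir_deriv_H:
  assumes p: "p \<in> M"
  shows "dir_deriv (\<lambda>q. H q y z) p x = A' (p $ 1) * x $ 1 * y $ 1 * z $ 1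
    + B' (p $ 1) * x $ 1 * hess f (plane p) (plane y) (plane z)
    + B (p $ 1) * cubic f (plane p) (plane y) (plane z) (plane x)"
proof -
  note Dh = has_derivative_compose[OF bounded_linear_imp_has_derivative[OF bounded_linear_plane]
      has_derivative_hess[OF f M_N[OF p], of "plane y" "plane z"]]
  have "((\<lambda>q. A (q $ 1) * y $ 1 * z $ 1 + B (q $ 1) * hess f (plane q) (plane y) (plane z)) has_derivative
     (\<lambda>x. A' (p $ 1) * x $ 1 * y $ 1 * z $ 1
    + B' (p $ 1) * x $ 1 * hess f (plane p) (plane y) (plane z)
    + B (p $ 1) * cubic f (plane p) (plane y) (plane z) (plane x))) (at p)"
    by (rule has_derivative_eq_rhs[OF has_derivative_add[OF
            has_derivative_mult_left[OF has_derivative_mult_left[OF has_derivative_t[OF A p]]]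
            has_derivative_mult[OF has_derivative_t[OF B p] Dh]]])
      (simp add: fun_eq_iff algebra_simps)
  then have "((\<lambda>q. H q y z) has_derivative
     (\<lambda>x. A' (p $ 1) * x $ 1 * y $ 1 * z $ 1
    + B' (p $ 1) * x $ 1 * hess f (plane p) (plane y) (plane z)
    + B (p $ 1) * cubic f (plane p) (plane y) (plane z) (plane x))) (at p)"
    by (rule has_derivative_transform_within_open[OF _ openM p]) (simp add: H)
  from frechet_derivative_at[OF this, symmetric] show ?thesis
    by (simp add: dir_deriv_def)
qed

text \<open>Since \<open>hess_det f = 1\<close>, the inverse of the Hessian matrix is its adjugate.\<close>

definition \<Gamma> :: "real^3 \<Rightarrow> real^3 \<Rightarrow> real^3 \<Rightarrow> real^3" where
  "\<Gamma> p x y = (let t = p $ 1; q = plane p; C = cubic f q (plane x) (plane y); g = hess f q in vector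
    [(A' t * x $ 1 * y $ 1 - B' t * g (plane x) (plane y)) / (2 * A t),
     B' t * (x $ 1 * y $ 2 + y $ 1 * x $ 2) / (2 * B t)
       + (g (axis 2 1) (axis 2 1) * C (axis 1 1) - g (axis 1 1) (axis 2 1) * C (axis 2 1)) / 2,
     B' t * (x $ 1 * y $ 3 + y $ 1 * x $ 3) / (2 * B t)
       + (g (axis 1 1) (axis 1 1) * C (axis 2 1) - g (axis 1 1) (axis 2 1) * C (axis 1 1)) / 2])"

text \<open>The right side is half of the Koszul expression. Its three third-derivative terms agree
  up to the order of arguments and enter with signs +, +, -, so one survives.\<close>

lemma H_\<Gamma>:
  assumes p: "p \<in> M"
  shows "H p (\<Gamma> p x y) z = (A' (p $ 1) * x $ 1 * y $ 1 * z $ 1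
    + B' (p $ 1) * (x $ 1 * hess f (plane p) (plane y) (plane z) + y $ 1 * hess f (plane p) (plane x) (plane z)
        - z $ 1 * hess f (plane p) (plane x) (plane y))
    + B (p $ 1) * cubic f (plane p) (plane x) (plane y) (plane z)) / 2"
proof -
  define q where "q = plane p"
  note N = M_N[OF p, folded q_def]
  define C where "C = cubic f q (plane x) (plane y)"
  define g11 g12 g22 where g: "g11 = hess f q (axis 1 1) (axis 1 1)" "g12 = hess f q (axis 1 1) (axis 2 1)"
    "g22 = hess f q (axis 2 1) (axis 2 1)"
  \<comment> \<open>\<open>W\<close> represents the linear form \<open>C\<close> through the
    Hessian: the adjugate, here the inverse, is applied to the coefficients of
    \<open>C\<close>.\<close>
  define W :: "real^2" where "W = vector [g22 * C (axis 1 1) - g12 * C (axis 2 1), g11 * C (axis 2 1) - g12 * C (axis 1 1)]"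
  have det: "g11 * g22 - g12 * g12 = 1"
    using det1[OF N] by (simp add: hess_det_def g power2_eq_square)
  have C: "C (plane z) = z $ 2 * C (axis 1 1) + z $ 3 * C (axis 2 1)"
    by (subst vec2_eq[of "plane z"]) (simp add: cubic_simps[OF openN f N] C_def)
  have W: "hess f q W (plane z) = C (plane z)"
    unfolding hess_coordinates[OF openN f N, folded g] C W_def plane_nth vector_2 using det by algebra
  have nz: "A (p $ 1) \<noteq> 0" "B (p $ 1) \<noteq> 0"
    using A_pos[OF M_I[OF p]] B_nz[OF p] by auto
  have "plane (\<Gamma> p x y) = (B' (p $ 1) / (2 * B (p $ 1))) *\<^sub>R (x $ 1 *\<^sub>R plane y + y $ 1 *\<^sub>R plane x) + (1 / 2) *\<^sub>R W"
    by (simp add: vec_eq_iff forall_2 \<Gamma>_def Let_def W_def g C_def q_def algebra_simps add_divide_distrib diff_divide_distrib)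
  then have 2: "hess f q (plane (\<Gamma> p x y)) (plane z) = B' (p $ 1) / (2 * B (p $ 1)) * (x $ 1 * hess f q (plane y) (plane z)
      + y $ 1 * hess f q (plane x) (plane z)) + C (plane z) / 2"
    by (simp only: symmetric_formD(2-5)[OF hess_form[OF p], folded q_def] W)
  have 1: "\<Gamma> p x y $ 1 = (A' (p $ 1) * x $ 1 * y $ 1 - B' (p $ 1) * hess f q (plane x) (plane y)) / (2 * A (p $ 1))"
    by (simp add: \<Gamma>_def Let_def q_def)
  have cancel: "a * (X / (2 * a)) = X / 2" "a * (b / (2 * a) * Y + Z / 2) = (b * Y + a * Z) / 2"
    if "a \<noteq> 0" for a b X Y Z :: real
    using that by (simp_all add: field_simps)
  show ?thesis
    unfolding H[OF p] q_def[symmetric] 1 2 cancel(1)[OF nz(1)] cancel(2)[OF nz(2)]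
    by (simp add: C_def field_simps)
qed

lemma smooth_\<Gamma>: "smooth_on M (\<lambda>p. \<Gamma> p x y)"
proof (rule smooth_on_vecI[OF openM])
  fix i :: 3
  note t = smooth_t[OF smooth_on_frechet_derivative[OF A]] smooth_t[OF smooth_on_frechet_derivative[OF B]]
    smooth_t[OF A] smooth_t[OF B]
  note q = smooth_q[OF smooth_on_hess[OF f]] smooth_q[OF smooth_on_cubic[OF f]]
  note c = smooth_on_add[OF openM] smooth_on_diff[OF openM] smooth_on_mult[OF openM] smooth_on_divide[OF openM]
    smooth_on_const
  have i: "i = 1 \<or> i = 2 \<or> i = 3" by (rule exhaust_3)
  have nz: "2 * A (p $ 1) \<noteq> 0" "2 * B (p $ 1) \<noteq> 0" if "p \<in> M" for p
    using A_pos[OF M_I[OF that]] B_nz[OF that] by auto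
  have 1: "smooth_on M (\<lambda>p. (A' (p $ 1) * x $ 1 * y $ 1 - B' (p $ 1) * hess f (plane p) (plane x) (plane y)) / (2 * A (p $ 1)))"
    by (rule c t q nz | assumption)+
  have 2: "smooth_on M (\<lambda>p. B' (p $ 1) * d / (2 * B (p $ 1)) + (hess f (plane p) (axis i 1) (axis i 1) * cubic f (plane p) (plane x) (plane y) (axis j 1)
     - hess f (plane p) (axis 1 1) (axis 2 1) * cubic f (plane p) (plane x) (plane y) (axis i 1)) / 2)" for d i j
    by (rule c t q nz | assumption | simp)+
  show "smooth_on M (\<lambda>p. \<Gamma> p x y $ i)"
    using i 1 2 by (auto simp: \<Gamma>_def Let_def)
qed

lemma bilinear_\<Gamma>: "p \<in> M \<Longrightarrow> bilinear (\<Gamma> p)"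
  unfolding bilinear_def
  by (intro conjI allI linearI)
    (simp_all add: \<Gamma>_def Let_def vec_eq_iff forall_3 plane_simps symmetric_formD(2-5)[OF hess_form]
      cubic_simps[OF openN f M_N] add_divide_distrib diff_divide_distrib algebra_simps)

lemma \<Gamma>_commute: "p \<in> M \<Longrightarrow> \<Gamma> p x y = \<Gamma> p y x"
  by (simp add: \<Gamma>_def Let_def symmetric_formD(1)[OF hess_form, of p "plane x" "plane y"]
      cubic_commute12[OF openN f M_N, of p "plane x" "plane y"] algebra_simps)

text \<open>\<open>levi_civita\<close> is a choice, so a witness has to exist before it has any
  property; the connection with Christoffel symbols \<open>\<Gamma>\<close> is one.\<close>

lemma is_levi_civita_levi_civita: "is_levi_civita M H (levi_civita M H)"
proof -
  have "is_levi_civita M H (\<lambda>X Y p. dir_deriv Y p (X p) + \<Gamma> p (X p) (Y p))"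
  proof (rule is_levi_civitaI[OF openM H_form _ bilinear_\<Gamma> \<Gamma>_commute smooth_\<Gamma>])
    fix x y
    have "smooth_on M (\<lambda>p. A (p $ 1) * x $ 1 * y $ 1 + B (p $ 1) * hess f (plane p) (plane x) (plane y))"
      by (intro smooth_on_add smooth_on_mult smooth_on_const openM smooth_t smooth_q smooth_on_hess A B f)
    then show "smooth_on M (\<lambda>p. H p x y)"
      by (rule smooth_on_cong[THEN iffD1, OF openM, rotated]) (simp add: H)
  next
    fix p x y z assume p: "p \<in> M"
    note cs = cubic_commute12[OF openN f M_N[OF p]] symmetric_formD(1)[OF cubic_symmetric_form[OF openN f M_N[OF p]]]
    have "cubic f (plane p) (plane y) (plane z) (plane x) = cubic f (plane p) (plane x) (plane y) (plane z)"
      "cubic f (plane p) (plane x) (plane z) (plane y) = cubic f (plane p) (plane x) (plane y) (plane z)"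
      using cs by metis+
    moreover have "hess f (plane p) (plane z) (plane y) = hess f (plane p) (plane y) (plane z)"
      by (rule symmetric_formD(1)[OF hess_form[OF p]])
    ultimately show "dir_deriv (\<lambda>q. H q y z) p x = H p (\<Gamma> p x y) z + H p y (\<Gamma> p x z)"
      unfolding dir_deriv_H[OF p] symmetric_formD(1)[OF H_form[OF p], of y] H_\<Gamma>[OF p]
      by (simp add: field_simps)
  qed
  then show ?thesis unfolding levi_civita_def by (rule someI[of "is_levi_civita M H"])
qed

text \<open>This comes from the Koszul formula, hence holds for whichever connection is
  chosen.\<close>

lemma H_levi_civita:
  assumes p: "p \<in> M"
  shows "2 * H p (levi_civita M H (\<lambda>_. x) (\<lambda>_. y) p) z = A' (p $ 1) * x $ 1 * y $ 1 * z $ 1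
    + B' (p $ 1) * (x $ 1 * hess f (plane p) (plane y) (plane z) + y $ 1 * hess f (plane p) (plane x) (plane z)
        - z $ 1 * hess f (plane p) (plane x) (plane y))
    + B (p $ 1) * cubic f (plane p) (plane x) (plane y) (plane z)"
proof -
  note cs = cubic_commute12[OF openN f M_N[OF p]] symmetric_formD(1)[OF cubic_symmetric_form[OF openN f M_N[OF p]]]
  have "cubic f (plane p) (plane y) (plane z) (plane x) = cubic f (plane p) (plane x) (plane y) (plane z)"
    "cubic f (plane p) (plane x) (plane z) (plane y) = cubic f (plane p) (plane x) (plane y) (plane z)"
    using cs by metis+
  then show ?thesis
    unfolding koszul[OF is_levi_civita_levi_civita p H_form[OF p]] dir_deriv_H[OF p]
    by (simp add: algebra_simps)
qed

section \<open>Rotations about the t-direction\<close>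

text \<open>\<open>a\<close> is \<partial>_t normalised, and Gram-Schmidt in the plane gives
  \<open>u\<close> and \<open>v\<close>. In such a basis the trace of the third derivative is a
  plain sum over \<open>u\<close> and \<open>v\<close>, the form in which
  \<open>apolar_cubic_rotation\<close> uses it.\<close>

lemma exists_orthonormal_triple:
  assumes p: "p \<in> M"
  obtains a u v where "orthonormal_triple (H p) a u v" "plane a = 0" "u $ 1 = 0" "v $ 1 = 0"
    "\<forall>z. cubic f (plane p) (plane u) (plane u) z + cubic f (plane p) (plane v) (plane v) z = 0"
proof -
  define q where "q = plane p"
  note N = M_N[OF p, folded q_def]
  define \<alpha> \<beta> where ab: "\<alpha> = A (p $ 1)" "\<beta> = B (p $ 1)"
  define g11 g12 g22 where g: "g11 = hess f q (axis 1 1) (axis 1 1)" "g12 = hess f q (axis 1 1) (axis 2 1)"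
    "g22 = hess f q (axis 2 1) (axis 2 1)"
  have det: "g11 * g22 - g12\<^sup>2 = 1"
    using det1[OF N] by (simp add: hess_det_def g)
  have pos: "\<beta> * g11 > 0" and \<alpha>: "\<alpha> > 0" and \<beta>: "\<beta> \<noteq> 0"
    using B_pos[OF M_I[OF p] N] A_pos[OF M_I[OF p]] B_nz[OF p] by (auto simp: ab g)
  \<comment> \<open>Gram-Schmidt is applied to \<beta> g, which is positive definite whichever sign
    \<beta> has.\<close>
  have det\<beta>: "(\<beta> * g11) * (\<beta> * g22) - (\<beta> * g12)\<^sup>2 = \<beta>\<^sup>2" using det by algebra
  have "(\<beta> * g11) * (\<beta> * g22) - (\<beta> * g12)\<^sup>2 > 0" unfolding det\<beta> using \<beta> by simp
  note gs = gram_schmidt_2[OF pos this, unfolded det\<beta>]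
  obtain r s w where rsw: "r\<^sup>2 * (\<beta> * g11) = 1" "s * (\<beta> * g11) + w * (\<beta> * g12) = 0"
    "s\<^sup>2 * (\<beta> * g11) + 2 * s * w * (\<beta> * g12) + w\<^sup>2 * (\<beta> * g22) = 1"
    and inv: "(r\<^sup>2 + s\<^sup>2) * \<beta>\<^sup>2 = \<beta> * g22" "s * w * \<beta>\<^sup>2 = - (\<beta> * g12)" "w\<^sup>2 * \<beta>\<^sup>2 = \<beta> * g11"
    by (rule gs)
  have inv': "(r\<^sup>2 + s\<^sup>2) * \<beta> = g22" "s * w * \<beta> = - g12" "w\<^sup>2 * \<beta> = g11"
  proof -
    have cancel: "x = y" if "\<beta> * x = \<beta> * y" for x y using that \<beta> by simp
    show "(r\<^sup>2 + s\<^sup>2) * \<beta> = g22" by (rule cancel) (use inv in algebra)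
    show "s * w * \<beta> = - g12" by (rule cancel) (use inv in algebra)
    show "w\<^sup>2 * \<beta> = g11" by (rule cancel) (use inv in algebra)
  qed
  define k where "k = 1 / sqrt \<alpha>"
  have k: "k\<^sup>2 * \<alpha> = 1" using \<alpha> by (simp add: k_def power_divide)
  define a u v :: "real^3" where auv: "a = vector [k, 0, 0]" "u = vector [0, r, 0]" "v = vector [0, s, w]"
  have H': "H p x y = \<alpha> * x $ 1 * y $ 1 + \<beta> * (x $ 2 * y $ 2 * g11 + (x $ 2 * y $ 3 + x $ 3 * y $ 2) * g12 + x $ 3 * y $ 3 * g22)" for x y
    unfolding H[OF p] q_def[symmetric] hess_coordinates[OF openN f N, folded g] by (simp add: ab)
  have "orthonormal_triple (H p) a u v"
  proof
    show "symmetric_form (H p)" by (rule H_form[OF p])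
    show "H p a a = 1" "H p u u = 1" "H p v v = 1" "H p a u = 0" "H p a v = 0"
      using k rsw by (simp_all add: H' auv power2_eq_square algebra_simps)
    have "H p u v = r * (s * (\<beta> * g11) + w * (\<beta> * g12))"
      by (simp add: H' auv algebra_simps)
    then show "H p u v = 0" using rsw by simp
    fix x
    \<comment> \<open>The expansion holds because the outer products of \<open>u\<close> and
      \<open>v\<close> in the plane sum to the inverse of \<beta> g, as \<open>inv'\<close>
      records.\<close>
    have "x $ 1 = H p x a * k" using k by (simp add: H' auv power2_eq_square algebra_simps)
    moreover have "x $ 2 = H p x u * r + H p x v * s"
    proof -
      have "H p x u * r + H p x v * s = (r\<^sup>2 + s\<^sup>2) * \<beta> * (x $ 2 * g11 + x $ 3 * g12) + s * w * \<beta> * (x $ 2 * g12 + x $ 3 * g22)"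
        by (simp add: H' auv power2_eq_square algebra_simps)
      also have "\<dots> = x $ 2" unfolding inv' using det by algebra
      finally show ?thesis by simp
    qed
    moreover have "x $ 3 = H p x v * w"
    proof -
      have "H p x v * w = s * w * \<beta> * (x $ 2 * g11 + x $ 3 * g12) + w\<^sup>2 * \<beta> * (x $ 2 * g12 + x $ 3 * g22)"
        by (simp add: H' auv power2_eq_square algebra_simps)
      also have "\<dots> = x $ 3" unfolding inv' using det by algebra
      finally show ?thesis by simp
    qed
    ultimately show "x = H p x a *\<^sub>R a + H p x u *\<^sub>R u + H p x v *\<^sub>R v"
      unfolding vec_eq_iff forall_3 by (simp add: auv)
  qed
  moreover have "plane a = 0" "u $ 1 = 0" "v $ 1 = 0"
    by (simp_all add: auv vec_eq_iff forall_2)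
  moreover have "cubic f q (plane u) (plane u) z + cubic f q (plane v) (plane v) z = 0" for z
  proof -
    define c11 c12 c22 where c: "c11 = cubic f q (axis 1 1) (axis 1 1) z" "c12 = cubic f q (axis 1 1) (axis 2 1) z"
      "c22 = cubic f q (axis 2 1) (axis 2 1) z"
    have pl: "plane u = r *\<^sub>R axis 1 1" "plane v = s *\<^sub>R axis 1 1 + w *\<^sub>R axis 2 1"
      by (simp_all add: auv vec_eq_iff forall_2 axis_def)
    have "cubic f q (plane u) (plane u) z + cubic f q (plane v) (plane v) z
        = (r\<^sup>2 + s\<^sup>2) * c11 + 2 * (s * w) * c12 + w\<^sup>2 * c22"
      unfolding pl c
      by (simp add: cubic_simps[OF openN f N] cubic_commute12[OF openN f N, of "axis 2 1" "axis 1 1"]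
          power2_eq_square algebra_simps)
    \<comment> \<open>By \<open>inv'\<close> the left side is \<beta> times the sum over
      \<open>u\<close> and \<open>v\<close>.\<close>
    moreover have "g22 * c11 - 2 * g12 * c12 + g11 * c22 = 0"
      using hess_det_const_derivative[OF openN f N det1, of z] by (simp add: g c)
    ultimately have "\<beta> * (cubic f q (plane u) (plane u) z + cubic f q (plane v) (plane v) z) = 0"
      using inv' by algebra
    then show ?thesis using \<beta> by simp
  qed
  ultimately show ?thesis
    using that unfolding q_def by blast
qed

text \<open>Paired with \<open>z\<close>, the difference tensor consists of first coordinates,
  values of the metric and of the Hessian, and the cubic form. Every rotation about \<open>a\<close>
  preserves the first three, and angles in the multiples of 2 pi / 3 preserve the last.\<close>

lemma Z3_symmetry_at:
  fixes S :: "real^3 \<Rightarrow> real^3" and conn :: "real^3 \<Rightarrow> real^3 \<Rightarrow> real^3"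
  assumes p: "p \<in> M"
    and conn: "\<And>x y. conn x y = (\<alpha> * x $ 1 * y $ 1 - \<mu> * H p x y) *\<^sub>R axis 1 1
       + \<beta> *\<^sub>R (x $ 1 *\<^sub>R y + y $ 1 *\<^sub>R x)"
    and S: "\<And>x. S x = \<sigma> *\<^sub>R x + (\<tau> * x $ 1) *\<^sub>R axis 1 1"
  defines "K \<equiv> \<lambda>x y. conn x y - levi_civita M H (\<lambda>_. x) (\<lambda>_. y) p"
  shows "\<exists>G. subgroup G (special_isometries (H p)) \<and>
     (\<exists>a u v. orthonormal_list (H p) [a, u, v] \<and> G = rotation (H p) a u v ` {of_int k * (2 * pi / 3) |k::int. True}) \<and>
     (\<forall>g\<in>G. (\<forall>x y. K (g x) (g y) = g (K x y)) \<and> (\<forall>x. S (g x) = g (S x)))"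
proof -
  obtain a u v where triple: "orthonormal_triple (H p) a u v" and a: "plane a = 0" and uv: "u $ 1 = 0" "v $ 1 = 0"
    and trace: "\<forall>z. cubic f (plane p) (plane u) (plane u) z + cubic f (plane p) (plane v) (plane v) z = 0"
    by (rule exists_orthonormal_triple[OF p])
  interpret orthonormal_triple "H p" a u v by (rule triple)
  define t where "t = p $ 1"
  define q where "q = plane p"
  note N = M_N[OF p, folded q_def]
  let ?A = "{of_int k * (2 * pi / 3) |k::int. True}"
  have sub: "subgroup (rotation (H p) a u v ` ?A) (special_isometries (H p))"
  proof (rule rotations_subgroup)
    show "0 \<in> ?A" by (rule CollectI, rule exI[of _ 0]) simp
    fix \<theta> assume "\<theta> \<in> ?A"
    then obtain k where k: "\<theta> = of_int k * (2 * pi / 3)" by blast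
    show "- \<theta> \<in> ?A" by (rule CollectI, rule exI[of _ "- k"]) (simp add: k)
    fix \<eta> assume "\<eta> \<in> ?A"
    then obtain l where l: "\<eta> = of_int l * (2 * pi / 3)" by blast
    show "\<theta> + \<eta> \<in> ?A" by (rule CollectI, rule exI[of _ "k + l"]) (simp add: k l algebra_simps add_divide_distrib)
  qed
  \<comment> \<open>Since \<open>u\<close> and \<open>v\<close> have no t-component and
    \<open>a\<close> has no plane component, the coordinate along \<open>a\<close> carries the
    t-part and the other two carry the plane part.\<close>
  have fst: "x $ 1 = H p x a * a $ 1" for x
    using arg_cong[OF expand[of x], of "\<lambda>x. x $ 1"] by (simp add: uv)
  have pl: "plane x = H p x u *\<^sub>R plane u + H p x v *\<^sub>R plane v" for x
    using arg_cong[OF expand[of x], of plane] by (simp add: plane_simps a)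
  have hess_inv: "B t * hess f q (plane x) (plane y) = H p x y - A t * x $ 1 * y $ 1" for x y
    by (simp add: H[OF p] t_def q_def)
  have axis: "H p (axis 1 1) z = A t * z $ 1" for z
  proof -
    have "plane (axis 1 1) = 0" by (simp add: vec_eq_iff forall_2 axis_def)
    then show ?thesis by (simp add: H[OF p] t_def axis_def symmetric_formD(10)[OF hess_form[OF p]])
  qed
  have equivariant: "K (g x) (g y) = g (K x y) \<and> S (g x) = g (S x)"
    if g: "g = rotation (H p) a u v \<theta>" and \<theta>: "\<theta> = of_int k * (2 * pi / 3)" for g \<theta> k x y
  proof
    have "cis \<theta> ^ 3 = cis (real 3 * \<theta>)" by (simp add: Complex.DeMoivre)
    also have "real 3 * \<theta> = 2 * pi * of_int k" by (simp add: \<theta>)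
    also have "cis \<dots> = 1" by (simp only: complex_eq_iff cis.simps sin_int_2pin cos_int_2pin one_complex.simps)
    finally have cis: "cis \<theta> ^ 3 = 1" .
    have g1: "g x $ 1 = x $ 1" for x
      using fst[of "g x"] fst[of x] by (simp add: g rotation_coordinates)
    have isom: "H p (g x) (g y) = H p x y" for x y
      unfolding g by (rule rotation_isometry)
    \<comment> \<open>B g is the metric minus A dt^2, both of which the rotation preserves.\<close>
    have gh: "B t * hess f q (plane (g x)) (plane (g y)) = B t * hess f q (plane x) (plane y)" for x y
      unfolding hess_inv isom g1 ..
    have "B t \<noteq> 0" using B_nz[OF p] by (simp add: t_def)
    then have gh': "hess f q (plane (g x)) (plane (g y)) = hess f q (plane x) (plane y)" for x y
      using gh by simp
    have plane_g: "plane (g x) = (cos \<theta> * H p x u - sin \<theta> * H p x v) *\<^sub>R plane u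
        + (sin \<theta> * H p x u + cos \<theta> * H p x v) *\<^sub>R plane v" for x
      by (simp add: pl[of "rotation (H p) a u v \<theta> x"] g rotation_coordinates)
    have cub: "cubic f q (plane (g x)) (plane (g y)) (plane (g z)) = cubic f q (plane x) (plane y) (plane z)" for x y z
      unfolding plane_g pl[of x] pl[of y] pl[of z]
      by (rule apolar_cubic_rotation[OF cubic_simps[OF openN f N] cubic_commute12[OF openN f N]
            symmetric_formD(1)[OF cubic_symmetric_form[OF openN f N]] trace[folded q_def, rule_format] cis refl refl])
    have HK: "H p (K x y) z = H p (conn x y) z - H p (levi_civita M H (\<lambda>_. x) (\<lambda>_. y) p) z" for x y z
      by (simp add: K_def form_simps)
    have Hconn: "H p (conn x y) z = (\<alpha> * x $ 1 * y $ 1 - \<mu> * H p x y) * (A t * z $ 1)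
        + \<beta> * (x $ 1 * H p y z + y $ 1 * H p x z)" for x y z
      by (simp add: conn form_simps axis)
    note lc = H_levi_civita[OF p, folded t_def q_def]
    have "2 * H p (K (g x) (g y)) (g z) = 2 * H p (K x y) z" for x y z
      unfolding HK right_diff_distrib lc Hconn g1 isom gh' cub ..
    then show "K (g x) (g y) = g (K x y)"
      unfolding g by (intro rotation_equivariantI) (simp add: g[symmetric])
    \<comment> \<open>\<partial>_t is orthogonal to \<open>u\<close> and \<open>v\<close>, so it
      lies on the axis.\<close>
    have "g (axis 1 1) = axis 1 1"
    proof (rule coordinates_eqI)
      have "H p (axis 1 1) u = 0" "H p (axis 1 1) v = 0" by (simp_all add: axis uv)
      then show "H p (g (axis 1 1)) u = H p (axis 1 1) u" "H p (g (axis 1 1)) v = H p (axis 1 1) v"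
        "H p (g (axis 1 1)) a = H p (axis 1 1) a"
        by (simp_all add: g rotation_coordinates)
    qed
    then show "S (g x) = g (S x)"
      unfolding S g1 using rotation_linear[of \<theta>] by (simp add: g linear_add linear_scale)
  qed
  show ?thesis
    by (rule exI[of _ "rotation (H p) a u v ` ?A"]) (use sub orthonormal_list equivariant in blast)
qed

end

section \<open>The hypersurface\<close>

lemma vector_4 [simp]:
  "(vector [w, x, y, z] :: 'a::zero^4) $ 1 = w"
  "(vector [w, x, y, z] :: 'a::zero^4) $ 2 = x"
  "(vector [w, x, y, z] :: 'a::zero^4) $ 3 = y"
  "(vector [w, x, y, z] :: 'a::zero^4) $ 4 = z"
  unfolding vector_def by simp_all

lemma det_4:
  "det (A :: 'a::comm_ring_1^4^4) =
    A$1$1 * (A$2$2 * A$3$3 * A$4$4 + A$2$3 * A$3$4 * A$4$2 + A$2$4 * A$3$2 * A$4$3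
      - A$2$2 * A$3$4 * A$4$3 - A$2$3 * A$3$2 * A$4$4 - A$2$4 * A$3$3 * A$4$2)
  - A$1$2 * (A$2$1 * A$3$3 * A$4$4 + A$2$3 * A$3$4 * A$4$1 + A$2$4 * A$3$1 * A$4$3
      - A$2$1 * A$3$4 * A$4$3 - A$2$3 * A$3$1 * A$4$4 - A$2$4 * A$3$3 * A$4$1)
  + A$1$3 * (A$2$1 * A$3$2 * A$4$4 + A$2$2 * A$3$4 * A$4$1 + A$2$4 * A$3$1 * A$4$2
      - A$2$1 * A$3$4 * A$4$2 - A$2$2 * A$3$1 * A$4$4 - A$2$4 * A$3$2 * A$4$1)
  - A$1$4 * (A$2$1 * A$3$2 * A$4$3 + A$2$2 * A$3$3 * A$4$1 + A$2$3 * A$3$1 * A$4$2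
      - A$2$1 * A$3$3 * A$4$2 - A$2$2 * A$3$1 * A$4$3 - A$2$3 * A$3$2 * A$4$1)"
proof -
  have f: "finite {2::4, 3, 4}" "1 \<notin> {2::4, 3, 4}" "finite {3::4, 4}" "2 \<notin> {3::4, 4}"
    "finite {4::4}" "3 \<notin> {4::4}"
    by auto
  show ?thesis
    unfolding det_def UNIV_4
    unfolding sum_over_permutations_insert[OF f(1,2)]
    unfolding sum_over_permutations_insert[OF f(3,4)]
    unfolding sum_over_permutations_insert[OF f(5,6)]
    unfolding permutes_sing
    by (simp add: sign_swap_id permutation_swap_id sign_compose sign_id permutation_compose transpose_def algebra_simps)
qed

text \<open>Exhibiting one decomposition evaluates both definite descriptions: two different
  coefficients of \<xi> would make \<xi> tangential, and equal ones leave injectivity of the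
  differential.\<close>

lemma tangential_transversal_part:
  assumes "immersion_on U F" "transversal_on U F \<xi>" "p \<in> U" and w: "w = dir_deriv F p z + c *\<^sub>R \<xi> p"
  shows "tangential_part F \<xi> p w = z" "transversal_part F \<xi> p w = c"
proof -
  have lin: "linear (dir_deriv F p)" and inj: "inj (dir_deriv F p)" and \<xi>: "\<xi> p \<notin> range (dir_deriv F p)"
    using assms(1-3) frechet_derivative_linear[of U F p]
    by (auto simp: immersion_on_def transversal_on_def dir_deriv_def[abs_def])
  have unique: "z' = z \<and> c' = c" if "w = dir_deriv F p z' + c' *\<^sub>R \<xi> p" for z' c'
  proof -
    have eq: "dir_deriv F p (z - z') = (c' - c) *\<^sub>R \<xi> p"
      using that w by (simp add: linear_diff[OF lin] algebra_simps)
    have "c' = c"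
    proof (rule ccontr)
      assume "c' \<noteq> c"
      then have "dir_deriv F p ((1 / (c' - c)) *\<^sub>R (z - z')) = \<xi> p"
        by (simp add: linear_scale[OF lin] eq)
      then show False using \<xi> by (metis rangeI)
    qed
    with eq have "dir_deriv F p (z - z') = dir_deriv F p 0" by (simp add: linear_0[OF lin])
    then have "z - z' = 0" using inj by (simp only: inj_eq)
    then show ?thesis using \<open>c' = c\<close> by simp
  qed
  show "tangential_part F \<xi> p w = z" "transversal_part F \<xi> p w = c"
    unfolding tangential_part_def transversal_part_def using unique w by (intro the_equality; blast)+
qed

lemma linear_plane_coordinates:
  fixes L :: "real^2 \<Rightarrow> real"
  shows "linear L \<Longrightarrow> L v = v $ 1 * L (axis 1 1) + v $ 2 * L (axis 2 1)"
  by (subst vec2_eq[of v]) (simp add: linear_add linear_scale)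

section \<open>The Monge-Ampere equation of an improper affine sphere\<close>

text \<open>For a graph with normal (0, 0, 1) the affine metric is the Hessian, and a frame (r, 0),
  (s, w) spans volume r w with the normal. The volume condition on one orthonormal frame then fixes
  the determinant.\<close>

lemma improper_affine_sphere_hess_det:
  assumes sphere: "improper_affine_sphere N (\<lambda>q. vector [q $ 1, q $ 2, f q]) (\<lambda>q. vector [0, 0, 1])"
    and q: "q \<in> N" and pos: "hess_det f q > 0"
  shows "hess_det f q = 1"
proof -
  let ?\<psi> = "\<lambda>q::real^2. vector [q $ 1, q $ 2, f q] :: real^3" and ?\<xi> = "\<lambda>q::real^2. vector [0, 0, 1] :: real^3"
  have imm: "immersion_on N ?\<psi>" and trans: "transversal_on N ?\<psi> ?\<xi>"
    and unit: "\<And>xs. length xs = 2 \<Longrightarrow> orthonormal_list (affine_metric ?\<psi> ?\<xi> q) xs \<Longrightarrow>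
      \<bar>det (vector (map (dir_deriv ?\<psi> q) xs @ [?\<xi> q]) :: real^3^3)\<bar> = 1"
    using sphere q by (auto simp: improper_affine_sphere_def affine_hypersurface_def affine_normal_def)
  have N: "open N" and "smooth_on N ?\<psi>" using imm by (auto simp: immersion_on_def)
  from smooth_on_nth[OF this, of 3] have f: "smooth_on N f" by simp
  have d\<psi>: "dir_deriv ?\<psi> q x = vector [x $ 1, x $ 2, frechet_derivative f (at q) x]" if "q \<in> N" for q x
  proof -
    have "(?\<psi> has_derivative (\<lambda>x. vector [x $ 1, x $ 2, frechet_derivative f (at q) x])) (at q)"
    proof (rule has_derivative_vecI)
      fix i :: 3
      show "((\<lambda>x. ?\<psi> x $ i) has_derivative (\<lambda>x. (vector [x $ 1, x $ 2, frechet_derivative f (at q) x] :: real^3) $ i)) (at q)"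
        using exhaust_3[of i] bounded_linear_imp_has_derivative[OF bounded_linear_vec_nth]
          smooth_on_has_derivative[OF f that] by auto
    qed
    from frechet_derivative_at[OF this, symmetric] show ?thesis by (simp add: dir_deriv_def)
  qed
  have metric: "affine_metric ?\<psi> ?\<xi> q x y = hess f q x y" for x y
  proof -
    have "((\<lambda>q. dir_deriv ?\<psi> q y) has_derivative (\<lambda>x. vector [0, 0, hess f q y x])) (at q)"
    proof (rule has_derivative_transform_within_open[OF _ N q])
      show "((\<lambda>q. vector [y $ 1, y $ 2, frechet_derivative f (at q) y]) has_derivative
          (\<lambda>x. vector [0, 0, hess f q y x] :: real^3)) (at q)"
      proof (rule has_derivative_vecI)
        fix i :: 3
        show "((\<lambda>q. (vector [y $ 1, y $ 2, frechet_derivative f (at q) y] :: real^3) $ i) has_derivative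
            (\<lambda>x. (vector [0, 0, hess f q y x] :: real^3) $ i)) (at q)"
          using exhaust_3[of i] smooth_on_has_derivative[OF smooth_on_frechet_derivative[OF f] q, of y]
          by (auto simp: hess_def[abs_def])
      qed
    qed (simp add: d\<psi>)
    from frechet_derivative_at[OF this, symmetric]
    have "dir_deriv (\<lambda>q. dir_deriv ?\<psi> q y) q x = vector [0, 0, hess f q y x]"
      by (simp add: dir_deriv_def[of "\<lambda>q. dir_deriv _ q y"])
    also have "\<dots> = dir_deriv ?\<psi> q 0 + hess f q y x *\<^sub>R ?\<xi> q"
      using linear_0[OF frechet_derivative_linear[OF f q]] by (simp add: d\<psi>[OF q] vec_eq_iff forall_3)
    finally have "affine_metric ?\<psi> ?\<xi> q x y = hess f q y x"
      unfolding affine_metric_def by (rule tangential_transversal_part(2)[OF imm trans q])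
    also have "\<dots> = hess f q x y" by (rule symmetric_formD(1)[OF hess_symmetric_form[OF N f q]])
    finally show ?thesis .
  qed
  define g11 g12 g22 where g: "g11 = hess f q (axis 1 1) (axis 1 1)" "g12 = hess f q (axis 1 1) (axis 2 1)"
    "g22 = hess f q (axis 2 1) (axis 2 1)"
  have det: "g11 * g22 - g12\<^sup>2 > 0" using pos by (simp add: hess_det_def g)
  \<comment> \<open>A positive determinant means that the Hessian is definite; \<sigma> is its sign.
    Gram-Schmidt is applied to \<sigma> times the Hessian, and \<open>orthonormal_list\<close>
    admits squares equal to -1.\<close>
  define \<sigma> where "\<sigma> = sgn g11"
  have "g11 \<noteq> 0" using det by (auto simp: not_less)
  then have \<sigma>: "\<sigma> * \<sigma> = 1" "\<sigma> * g11 > 0" by (auto simp: \<sigma>_def sgn_if)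
  have d\<sigma>: "\<sigma> * g11 * (\<sigma> * g22) - (\<sigma> * g12)\<^sup>2 = g11 * g22 - g12\<^sup>2"
    using \<sigma>(1) by algebra
  note gs = gram_schmidt_2[OF \<sigma>(2), of "\<sigma> * g22" "\<sigma> * g12", unfolded d\<sigma>, OF det]
  obtain r s w where rsw: "r\<^sup>2 * (\<sigma> * g11) = 1" "s * (\<sigma> * g11) + w * (\<sigma> * g12) = 0"
      "s\<^sup>2 * (\<sigma> * g11) + 2 * s * w * (\<sigma> * g12) + w\<^sup>2 * (\<sigma> * g22) = 1"
    and w: "w\<^sup>2 * (g11 * g22 - g12\<^sup>2) = \<sigma> * g11"
    by (rule gs)
  let ?u = "vector [r, 0] :: real^2" and ?v = "vector [s, w] :: real^2"
  note hc = hess_coordinates[OF N f q, folded g]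
  have "hess f q ?u ?u = \<sigma>" "hess f q ?v ?v = \<sigma>" "hess f q ?u ?v = 0" "hess f q ?v ?u = 0"
    unfolding hc vector_2 using rsw \<sigma>(1) by algebra+
  moreover have "\<bar>\<sigma>\<bar> = 1" using \<open>g11 \<noteq> 0\<close> by (simp add: \<sigma>_def)
  ultimately have "orthonormal_list (affine_metric ?\<psi> ?\<xi> q) [?u, ?v]"
    by (auto simp: orthonormal_list_def metric less_Suc_eq)
  from unit[OF _ this] have "\<bar>r * w\<bar> = 1"
    by (simp add: det_3 d\<psi>[OF q])
  then have "(r * w)\<^sup>2 = 1" by (metis abs_one power2_abs power_one)
  then have "g11 * g22 - g12\<^sup>2 = 1" using w rsw(1) by algebra
  then show ?thesis by (simp add: hess_det_def g)
qed

section \<open>The hypersurface and its derivatives\<close>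

text \<open>With t = \<open>p $ 1\<close> the map is \<open>F p\<close> = a(t) (u, v, f, 1) + b(t)
  e3: a cone over the graph placed at height 1, shifted along e3.\<close>

locale cone_hypersurface = product_chart I N M
  for I :: "real set" and N :: "(real^2) set" and M :: "(real^3) set" +
  fixes f :: "real^2 \<Rightarrow> real" and \<gamma> :: "real \<Rightarrow> real^2"
    and F :: "real^3 \<Rightarrow> real^4" and \<xi> :: "real^3 \<Rightarrow> real^4"
  assumes sphere: "improper_affine_sphere N (\<lambda>q. vector [q $ 1, q $ 2, f q]) (\<lambda>q. vector [0, 0, 1])"
    and \<gamma>: "smooth_on I \<gamma>"
    and F: "F = (\<lambda>p. vector [(\<gamma> (p $ 1) $ 1) * p $ 2, (\<gamma> (p $ 1) $ 1) * p $ 3,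
           (\<gamma> (p $ 1) $ 1) * f (plane p) + \<gamma> (p $ 1) $ 2, \<gamma> (p $ 1) $ 1])"
    and hyp: "affine_hypersurface M F \<xi>"
    and pos: "positive_definite_on M (affine_metric F \<xi>)"
begin

abbreviation D where "D c \<equiv> (\<lambda>t::real. frechet_derivative c (at t) (1::real) :: real)"
abbreviation a where "a \<equiv> (\<lambda>t. \<gamma> t $ 1)"
abbreviation b where "b \<equiv> (\<lambda>t. \<gamma> t $ 2)"
abbreviation df where "df q \<equiv> frechet_derivative f (at q)"
abbreviation h where "h \<equiv> affine_metric F \<xi>"
abbreviation e3 :: "real^4" where "e3 \<equiv> axis 3 1"

lemma smooth_a: "smooth_on I a" and smooth_b: "smooth_on I b"
  by (rule smooth_on_nth[OF openI \<gamma>])+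

lemmas smooth_D = smooth_on_frechet_derivative[where v = "1::real"]

lemma f: "smooth_on N f"
proof -
  have "smooth_on N (\<lambda>q::real^2. vector [q $ 1, q $ 2, f q] :: real^3)"
    using sphere by (simp add: improper_affine_sphere_def affine_hypersurface_def immersion_on_def)
  from smooth_on_nth[OF openN this, of 3] show ?thesis by simp
qed

lemma immersion: "immersion_on M F" and transversal: "transversal_on M F \<xi>"
  and smooth_\<xi>: "smooth_on M \<xi>"
  using hyp by (auto simp: affine_hypersurface_def affine_normal_def transversal_on_def)

lemma linear_df: "p \<in> M \<Longrightarrow> linear (df (plane p))"
  by (rule frechet_derivative_linear[OF f M_N])

lemma has_derivative_nth: "((\<lambda>p. p $ i) has_derivative (\<lambda>x. x $ i)) (at p)" for p :: "real^3"
  by (rule bounded_linear_imp_has_derivative[OF bounded_linear_vec_nth])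

lemma dir_deriv_F:
  assumes p: "p \<in> M"
  shows "dir_deriv F p x = vector
    [D a (p $ 1) * x $ 1 * p $ 2 + a (p $ 1) * x $ 2, D a (p $ 1) * x $ 1 * p $ 3 + a (p $ 1) * x $ 3,
     D a (p $ 1) * x $ 1 * f (plane p) + a (p $ 1) * df (plane p) (plane x) + D b (p $ 1) * x $ 1, D a (p $ 1) * x $ 1]"
proof -
  note A = has_derivative_t[OF smooth_a p] and B = has_derivative_t[OF smooth_b p] and Q = has_derivative_q[OF f p]
  have "(F has_derivative (\<lambda>x. vector
    [D a (p $ 1) * x $ 1 * p $ 2 + a (p $ 1) * x $ 2, D a (p $ 1) * x $ 1 * p $ 3 + a (p $ 1) * x $ 3,
     D a (p $ 1) * x $ 1 * f (plane p) + a (p $ 1) * df (plane p) (plane x) + D b (p $ 1) * x $ 1, D a (p $ 1) * x $ 1])) (at p)"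
    unfolding F
  proof (rule has_derivative_vecI, goal_cases)
    case (1 i)
    show ?case
      using exhaust_4[of i]
        has_derivative_eq_rhs[OF has_derivative_mult[OF A has_derivative_nth[of 2]],
          of "\<lambda>x. D a (p $ 1) * x $ 1 * p $ 2 + a (p $ 1) * x $ 2"]
        has_derivative_eq_rhs[OF has_derivative_mult[OF A has_derivative_nth[of 3]],
          of "\<lambda>x. D a (p $ 1) * x $ 1 * p $ 3 + a (p $ 1) * x $ 3"]
        has_derivative_eq_rhs[OF has_derivative_add[OF has_derivative_mult[OF A Q] B],
          of "\<lambda>x. D a (p $ 1) * x $ 1 * f (plane p) + a (p $ 1) * df (plane p) (plane x) + D b (p $ 1) * x $ 1"]
        A by (auto simp: fun_eq_iff)
  qed
  from frechet_derivative_at[OF this, symmetric] show ?thesis by (simp add: dir_deriv_def)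
qed

lemma second_derivative_F:
  assumes p: "p \<in> M"
  shows "dir_deriv (\<lambda>q. dir_deriv F q y) p x = vector
    [D (D a) (p $ 1) * x $ 1 * y $ 1 * p $ 2 + D a (p $ 1) * (y $ 1 * x $ 2 + x $ 1 * y $ 2),
     D (D a) (p $ 1) * x $ 1 * y $ 1 * p $ 3 + D a (p $ 1) * (y $ 1 * x $ 3 + x $ 1 * y $ 3),
     D (D a) (p $ 1) * x $ 1 * y $ 1 * f (plane p)
       + D a (p $ 1) * (y $ 1 * df (plane p) (plane x) + x $ 1 * df (plane p) (plane y))
       + a (p $ 1) * hess f (plane p) (plane x) (plane y) + D (D b) (p $ 1) * x $ 1 * y $ 1,
     D (D a) (p $ 1) * x $ 1 * y $ 1]" (is "_ = ?V x")
proof -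
  note A = has_derivative_t[OF smooth_a p] and Q = has_derivative_q[OF f p]
    and A1 = has_derivative_t[OF smooth_D[OF smooth_a] p] and B1 = has_derivative_t[OF smooth_D[OF smooth_b] p]
    and Q1 = has_derivative_q[OF smooth_on_frechet_derivative[OF f, of "plane y"] p]
  have hess: "frechet_derivative (\<lambda>q. df q (plane y)) (at (plane p)) (plane x) = hess f (plane p) (plane x) (plane y)" for x
    using symmetric_formD(1)[OF hess_symmetric_form[OF openN f M_N[OF p]]] by (simp add: hess_def)
  have "((\<lambda>q. vector [D a (q $ 1) * y $ 1 * q $ 2 + a (q $ 1) * y $ 2, D a (q $ 1) * y $ 1 * q $ 3 + a (q $ 1) * y $ 3,
     D a (q $ 1) * y $ 1 * f (plane q) + a (q $ 1) * df (plane q) (plane y) + D b (q $ 1) * y $ 1, D a (q $ 1) * y $ 1])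
     has_derivative ?V) (at p)"
  proof (rule has_derivative_vecI, goal_cases)
    case (1 i)
    have 1: "((\<lambda>q. D a (q $ 1) * y $ 1 * q $ j + a (q $ 1) * y $ j) has_derivative
        (\<lambda>x. D (D a) (p $ 1) * x $ 1 * y $ 1 * p $ j + D a (p $ 1) * (y $ 1 * x $ j + x $ 1 * y $ j))) (at p)" for j
      by (rule has_derivative_eq_rhs[OF has_derivative_add[OF
              has_derivative_mult[OF has_derivative_mult_left[OF A1] has_derivative_nth] has_derivative_mult_left[OF A]]])
        (simp add: fun_eq_iff algebra_simps)
    have 2: "((\<lambda>q. D a (q $ 1) * y $ 1 * f (plane q) + a (q $ 1) * df (plane q) (plane y) + D b (q $ 1) * y $ 1)
        has_derivative (\<lambda>x. D (D a) (p $ 1) * x $ 1 * y $ 1 * f (plane p)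
       + D a (p $ 1) * (y $ 1 * df (plane p) (plane x) + x $ 1 * df (plane p) (plane y))
       + a (p $ 1) * hess f (plane p) (plane x) (plane y) + D (D b) (p $ 1) * x $ 1 * y $ 1)) (at p)"
      by (rule has_derivative_eq_rhs[OF has_derivative_add[OF has_derivative_add[OF
              has_derivative_mult[OF has_derivative_mult_left[OF A1] Q] has_derivative_mult[OF A Q1]]
              has_derivative_mult_left[OF B1]]])
        (simp add: fun_eq_iff algebra_simps hess)
    have 3: "((\<lambda>q. D a (q $ 1) * y $ 1) has_derivative (\<lambda>x. D (D a) (p $ 1) * x $ 1 * y $ 1)) (at p)"
      by (rule has_derivative_mult_left[OF A1])
    show ?case
      using exhaust_4[of i] 1[of 2] 1[of 3] 2 3 by (elim disjE) (simp_all only: vector_4)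
  qed
  then have "((\<lambda>q. dir_deriv F q y) has_derivative ?V) (at p)"
    by (rule has_derivative_transform_within_open[OF _ openM p]) (simp only: dir_deriv_F)
  from frechet_derivative_at[OF this, symmetric] show ?thesis
    by (simp only: dir_deriv_def[of "\<lambda>q. dir_deriv _ q y"])
qed

section \<open>Nonvanishing of a and a', splitting along e3, affine metric\<close>

text \<open>Where \<open>a\<close> vanishes, the differential of \<open>F\<close> kills
  \<partial>_u.\<close>

lemma a_nz:
  assumes p: "p \<in> M"
  shows "a (p $ 1) \<noteq> 0"
proof
  assume 0: "a (p $ 1) = 0"
  have "dir_deriv F p (axis 2 1) = dir_deriv F p 0"
    unfolding dir_deriv_F[OF p] by (simp add: 0 axis_def)
  then have "axis 2 1 = (0 :: real^3)"
    using immersion p by (simp only: immersion_on_def inj_eq)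
  then show False by (simp add: axis_eq_0_iff)
qed

text \<open>If \<open>a' = 0\<close>, then \<open>e3\<close> is tangent to the hypersurface, whereas all second derivatives of \<open>F\<close>
  in \<open>u\<close> and \<open>v\<close> are multiples of \<open>e3\<close>; so \<open>h\<close> would vanish on \<open>\<partial>\<^sub>u\<close>.\<close>

lemma Da_nz:
  assumes p: "p \<in> M"
  shows "D a (p $ 1) \<noteq> 0"
proof
  assume 0: "D a (p $ 1) = 0"
  have pl: "plane (axis 1 1) = 0" by (simp add: vec_eq_iff forall_2 axis_def)
  have F1: "dir_deriv F p (axis 1 1) = D b (p $ 1) *\<^sub>R e3"
    unfolding dir_deriv_F[OF p] pl using linear_0[OF linear_df[OF p]]
    by (simp add: 0 axis_def vec_eq_iff forall_4)
  have lin: "linear (dir_deriv F p)" and inj: "inj (dir_deriv F p)"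
    using immersion p frechet_derivative_linear[of M F p] by (auto simp: immersion_on_def dir_deriv_def[abs_def])
  have "D b (p $ 1) \<noteq> 0"
  proof
    assume "D b (p $ 1) = 0"
    then have "dir_deriv F p (axis 1 1) = dir_deriv F p 0" using F1 by (simp add: linear_0[OF lin])
    then have "axis 1 1 = (0 :: real^3)" using inj by (simp only: inj_eq)
    then show False by (simp add: axis_eq_0_iff)
  qed
  then have e3: "e3 = dir_deriv F p ((1 / D b (p $ 1)) *\<^sub>R axis 1 1)"
    by (simp add: linear_scale[OF lin] F1)
  let ?c = "a (p $ 1) * hess f (plane p) (plane (axis 2 1)) (plane (axis 2 1))"
  have "dir_deriv (\<lambda>q. dir_deriv F q (axis 2 1)) p (axis 2 1) = ?c *\<^sub>R e3"
    unfolding second_derivative_F[OF p] by (simp add: axis_def vec_eq_iff forall_4)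
  also have "\<dots> = dir_deriv F p (?c *\<^sub>R (1 / D b (p $ 1)) *\<^sub>R axis 1 1) + 0 *\<^sub>R \<xi> p"
    using e3 by (simp only: linear_scale[OF lin, of ?c]) simp
  finally have "h p (axis 2 1) (axis 2 1) = 0"
    unfolding affine_metric_def by (rule tangential_transversal_part(2)[OF immersion transversal p])
  moreover have "h p (axis 2 1) (axis 2 1) > 0"
    using pos p by (simp add: positive_definite_on_def axis_eq_0_iff)
  ultimately show False by simp
qed

text \<open>\<open>\<nu>\<close> is the conormal normalised by \<open>\<nu> p e3 = 1\<close>.\<close>

definition \<nu> :: "real^3 \<Rightarrow> real^4 \<Rightarrow> real" where
  "\<nu> p w = w $ 3 - (w $ 1 - p $ 2 * w $ 4) * df (plane p) (axis 1 1)
     - (w $ 2 - p $ 3 * w $ 4) * df (plane p) (axis 2 1) - (f (plane p) + D b (p $ 1) / D a (p $ 1)) * w $ 4"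

text \<open>The tangential coordinates in the splitting of the ambient space by e3: the fourth entry
  of a tangent vector determines its t-component, after which the first two entries give the plane
  part.\<close>

definition tang :: "real^3 \<Rightarrow> real^4 \<Rightarrow> real^3" where
  "tang p w = vector [w $ 4 / D a (p $ 1), (w $ 1 - p $ 2 * w $ 4) / a (p $ 1), (w $ 2 - p $ 3 * w $ 4) / a (p $ 1)]"

lemma decompose:
  assumes p: "p \<in> M"
  shows "w = dir_deriv F p (tang p w) + \<nu> p w *\<^sub>R e3"
  unfolding vec_eq_iff forall_4 dir_deriv_F[OF p] linear_plane_coordinates[OF linear_df[OF p], of "plane _"]
  using a_nz[OF p] Da_nz[OF p] by (simp add: tang_def \<nu>_def axis_def field_simps)

lemma \<nu>_dir_deriv:
  assumes p: "p \<in> M"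
  shows "\<nu> p (dir_deriv F p x) = 0"
  unfolding dir_deriv_F[OF p] \<nu>_def linear_plane_coordinates[OF linear_df[OF p], of "plane _"]
  using Da_nz[OF p] by (simp add: field_simps)

definition \<phi> :: "real^3 \<Rightarrow> real" where "\<phi> p = \<nu> p (\<xi> p)"

lemma \<phi>_nz:
  assumes p: "p \<in> M"
  shows "\<phi> p \<noteq> 0"
proof
  assume "\<phi> p = 0"
  then have "\<xi> p = dir_deriv F p (tang p (\<xi> p))"
    using decompose[OF p, of "\<xi> p"] by (simp add: \<phi>_def)
  moreover have "\<xi> p \<notin> range (dir_deriv F p)"
    using transversal p by (simp add: transversal_on_def)
  ultimately show False by (metis rangeI)
qed

text \<open>Solving \<xi> = dF(tang \<xi>) + \<phi> e3 for e3 and inserting this in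
  \<open>decompose\<close> changes the transversal field from e3 to \<xi>.\<close>

lemma parts:
  assumes p: "p \<in> M"
  shows "tangential_part F \<xi> p w = tang p w - (\<nu> p w / \<phi> p) *\<^sub>R tang p (\<xi> p)"
    "transversal_part F \<xi> p w = \<nu> p w / \<phi> p"
proof -
  have lin: "linear (dir_deriv F p)"
    using immersion p frechet_derivative_linear[of M F p] by (auto simp: immersion_on_def dir_deriv_def[abs_def])
  have "dir_deriv F p (tang p w - (\<nu> p w / \<phi> p) *\<^sub>R tang p (\<xi> p)) + (\<nu> p w / \<phi> p) *\<^sub>R \<xi> p
      = dir_deriv F p (tang p w) - (\<nu> p w / \<phi> p) *\<^sub>R dir_deriv F p (tang p (\<xi> p))
        + (\<nu> p w / \<phi> p) *\<^sub>R (dir_deriv F p (tang p (\<xi> p)) + \<phi> p *\<^sub>R e3)"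
    using decompose[OF p, of "\<xi> p"] by (simp add: linear_diff[OF lin] linear_scale[OF lin] \<phi>_def)
  also have "\<dots> = dir_deriv F p (tang p w) + \<nu> p w *\<^sub>R e3"
    using \<phi>_nz[OF p] by (simp add: algebra_simps)
  also have "\<dots> = w" by (rule decompose[OF p, symmetric])
  finally have w: "w = dir_deriv F p (tang p w - (\<nu> p w / \<phi> p) *\<^sub>R tang p (\<xi> p)) + (\<nu> p w / \<phi> p) *\<^sub>R \<xi> p" ..
  show "tangential_part F \<xi> p w = tang p w - (\<nu> p w / \<phi> p) *\<^sub>R tang p (\<xi> p)"
    "transversal_part F \<xi> p w = \<nu> p w / \<phi> p"
    by (rule tangential_transversal_part[OF immersion transversal p w])+
qed

text \<open>The e3-component of the second t-derivative of \<open>F\<close>: F_tt = (a''/a') F_t +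
  \<lambda> e3.\<close>

definition lam :: "real \<Rightarrow> real" where
  "lam t = D (D b) t - D (D a) t * D b t / D a t"

text \<open>There are no mixed terms because F_tu = (a'/a) F_u is tangential; second derivatives
  within the plane are \<open>a\<close> times the Hessian in direction e3.\<close>

lemma metric:
  assumes p: "p \<in> M"
  shows "h p x y = (lam (p $ 1) * x $ 1 * y $ 1 + a (p $ 1) * hess f (plane p) (plane x) (plane y)) / \<phi> p"
proof -
  have "\<nu> p (dir_deriv (\<lambda>q. dir_deriv F q y) p x) = lam (p $ 1) * x $ 1 * y $ 1 + a (p $ 1) * hess f (plane p) (plane x) (plane y)"
    unfolding second_derivative_F[OF p] \<nu>_def lam_def
      linear_plane_coordinates[OF linear_df[OF p], of "plane x"] linear_plane_coordinates[OF linear_df[OF p], of "plane y"]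
    using Da_nz[OF p] by (simp add: field_simps)
  then show ?thesis by (simp add: affine_metric_def parts[OF p])
qed

lemma lam_pos:
  assumes p: "p \<in> M"
  shows "lam (p $ 1) / \<phi> p > 0"
proof -
  have "h p (axis 1 1) (axis 1 1) > 0"
    using pos p by (simp add: positive_definite_on_def axis_eq_0_iff)
  moreover have "plane (axis 1 1) = 0" by (simp add: vec_eq_iff forall_2 axis_def)
  ultimately show ?thesis
    using symmetric_formD(11)[OF hess_symmetric_form[OF openN f M_N[OF p]]]
    by (simp add: metric[OF p] axis_def)
qed

text \<open>Positive definiteness on vectors tangent to the plane forces a positive Hessian
  determinant, which is the premise for the Monge-Ampere equation.\<close>

lemma hess_pos:
  assumes p: "p \<in> M"
  shows "a (p $ 1) / \<phi> p * hess f (plane p) (axis 1 1) (axis 1 1) > 0" "hess_det f (plane p) = 1"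
proof -
  define g11 g12 g22 where g: "g11 = hess f (plane p) (axis 1 1) (axis 1 1)"
    "g12 = hess f (plane p) (axis 1 1) (axis 2 1)" "g22 = hess f (plane p) (axis 2 1) (axis 2 1)"
  note hc = hess_coordinates[OF openN f M_N[OF p], folded g]
  have *: "a (p $ 1) / \<phi> p * (x * x * g11 + 2 * x * y * g12 + y * y * g22) > 0" if "x \<noteq> 0 \<or> y \<noteq> 0" for x y
  proof -
    have "vector [0, x, y] \<noteq> (0 :: real^3)"
      using that by (auto simp: vec_eq_iff forall_3)
    then have "h p (vector [0, x, y]) (vector [0, x, y]) > 0"
      using pos p by (simp add: positive_definite_on_def)
    then show ?thesis by (simp add: metric[OF p] hc algebra_simps add_divide_distrib)
  qed
  show pos11: "a (p $ 1) / \<phi> p * hess f (plane p) (axis 1 1) (axis 1 1) > 0"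
    using *[of 1 0] by (simp add: g)
  then have g11: "a (p $ 1) / \<phi> p * g11 > 0" by (simp add: g)
  then have "g11 \<noteq> 0" by auto
  \<comment> \<open>On (-g12, g11) the Hessian takes the value g11 times its determinant.\<close>
  then have "a (p $ 1) / \<phi> p * (g12 * g12 * g11 + 2 * - g12 * g11 * g12 + g11 * g11 * g22) > 0"
    using *[of "- g12" g11] by simp
  then have "(a (p $ 1) / \<phi> p * g11) * (g11 * g22 - g12\<^sup>2) > 0"
    by (simp add: algebra_simps power2_eq_square)
  then have "g11 * g22 - g12\<^sup>2 > 0" using g11 zero_less_mult_pos by blast
  then have "hess_det f (plane p) > 0" by (simp add: hess_det_def g)
  then show "hess_det f (plane p) = 1"
    by (rule improper_affine_sphere_hess_det[OF sphere M_N[OF p]])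
qed

text \<open>This is the volume condition on \<open>\<xi>\<close>, evaluated on one orthonormal frame.\<close>

lemma \<phi>_power5:
  assumes p: "p \<in> M"
  shows "\<phi> p ^ 5 * (a (p $ 1))\<^sup>2 * (D a (p $ 1))\<^sup>2 = lam (p $ 1)"
proof -
  define \<beta> where "\<beta> = a (p $ 1) / \<phi> p"
  define g11 g12 g22 where g: "g11 = hess f (plane p) (axis 1 1) (axis 1 1)"
    "g12 = hess f (plane p) (axis 1 1) (axis 2 1)" "g22 = hess f (plane p) (axis 2 1) (axis 2 1)"
  note hc = hess_coordinates[OF openN f M_N[OF p], folded g]
  have \<beta>: "\<beta> \<noteq> 0" using a_nz[OF p] \<phi>_nz[OF p] by (simp add: \<beta>_def)
  have pos: "\<beta> * g11 > 0" and det: "g11 * g22 - g12\<^sup>2 = 1"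
    using hess_pos[OF p] by (simp_all add: \<beta>_def g hess_det_def)
  have det\<beta>: "(\<beta> * g11) * (\<beta> * g22) - (\<beta> * g12)\<^sup>2 = \<beta>\<^sup>2" using det by algebra
  have "(\<beta> * g11) * (\<beta> * g22) - (\<beta> * g12)\<^sup>2 > 0" unfolding det\<beta> using \<beta> by simp
  note gs = gram_schmidt_2[OF pos this, unfolded det\<beta>]
  obtain r s w where rsw: "r\<^sup>2 * (\<beta> * g11) = 1" "s * (\<beta> * g11) + w * (\<beta> * g12) = 0"
      "s\<^sup>2 * (\<beta> * g11) + 2 * s * w * (\<beta> * g12) + w\<^sup>2 * (\<beta> * g22) = 1"
    and w: "w\<^sup>2 * \<beta>\<^sup>2 = \<beta> * g11"
    by (rule gs)
  \<comment> \<open>Normalises \<partial>_t; \<open>?y\<close> and \<open>?z\<close> complete the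
    frame by Gram-Schmidt in the plane.\<close>
  define k where "k = 1 / sqrt (lam (p $ 1) / \<phi> p)"
  have k: "k\<^sup>2 * (lam (p $ 1) / \<phi> p) = 1"
    unfolding k_def power_divide real_sqrt_pow2[OF less_imp_le[OF lam_pos[OF p]]] using lam_pos[OF p] by auto
  have metric': "h p x y = lam (p $ 1) / \<phi> p * x $ 1 * y $ 1
      + \<beta> * (x $ 2 * y $ 2 * g11 + (x $ 2 * y $ 3 + x $ 3 * y $ 2) * g12 + x $ 3 * y $ 3 * g22)" for x y
    unfolding metric[OF p] hc \<beta>_def by (simp add: add_divide_distrib)
  let ?x = "vector [k, 0, 0] :: real^3" and ?y = "vector [0, r, 0] :: real^3" and ?z = "vector [0, s, w] :: real^3"
  have "h p ?x ?x = 1" "h p ?y ?y = 1" "h p ?z ?z = 1" "h p ?x ?y = 0" "h p ?x ?z = 0" "h p ?y ?x = 0" "h p ?z ?x = 0"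
    unfolding metric' vector_3 using k rsw by algebra+
  moreover have "h p ?y ?z = r * (s * (\<beta> * g11) + w * (\<beta> * g12))" "h p ?z ?y = r * (s * (\<beta> * g11) + w * (\<beta> * g12))"
    unfolding metric' vector_3 by algebra+
  ultimately have "orthonormal_list (h p) [?x, ?y, ?z]"
    by (auto simp: orthonormal_list_def less_Suc_eq rsw(2))
  moreover have "\<And>xs. length xs = 3 \<Longrightarrow> orthonormal_list (h p) xs \<Longrightarrow>
      \<bar>det (vector (map (dir_deriv F p) xs @ [\<xi> p]) :: real^4^4)\<bar> = 1"
    using hyp p by (auto simp: affine_hypersurface_def affine_normal_def)
  ultimately have "\<bar>det (vector (map (dir_deriv F p) [?x, ?y, ?z] @ [\<xi> p]) :: real^4^4)\<bar> = 1"
    by (metis length_Cons list.size(3) numeral_3_eq_3)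
  moreover have "det (vector (map (dir_deriv F p) [?x, ?y, ?z] @ [\<xi> p]) :: real^4^4)
      = - (k * r * w * (a (p $ 1))\<^sup>2 * D a (p $ 1) * \<phi> p)"
    unfolding \<phi>_def \<nu>_def using Da_nz[OF p]
    by (simp add: dir_deriv_F[OF p] linear_plane_coordinates[OF linear_df[OF p], of "plane _"] det_4)
      (simp add: field_simps power2_eq_square)
  ultimately have "\<bar>k * r * w * (a (p $ 1))\<^sup>2 * D a (p $ 1) * \<phi> p\<bar> = 1" by simp
  then have vol: "(k * r * w * (a (p $ 1))\<^sup>2 * D a (p $ 1) * \<phi> p)\<^sup>2 = 1"
    by (metis abs_one power2_abs power_one)
  have k': "k\<^sup>2 * lam (p $ 1) = \<phi> p" using k \<phi>_nz[OF p] by (simp add: field_simps)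
  have a: "a (p $ 1) = \<beta> * \<phi> p" using \<phi>_nz[OF p] by (simp add: \<beta>_def)
  have rw: "r\<^sup>2 * w\<^sup>2 * \<beta>\<^sup>2 = 1" using rsw(1) w by algebra
  \<comment> \<open>Two of the four factors \<open>a\<close> in the squared volume are written as
    \<beta> \<phi>, so that the frame constants cancel; k^2 \<lambda> supplies the fifth factor
    \<phi>.\<close>
  have "lam (p $ 1) = lam (p $ 1) * (k * r * w * (a (p $ 1))\<^sup>2 * D a (p $ 1) * \<phi> p)\<^sup>2" using vol by simp
  also have "\<dots> = (k\<^sup>2 * lam (p $ 1)) * (r\<^sup>2 * w\<^sup>2 * \<beta>\<^sup>2) * (\<phi> p)\<^sup>2 * (\<phi> p)\<^sup>2 * (a (p $ 1))\<^sup>2 * (D a (p $ 1))\<^sup>2"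
    unfolding a by algebra
  finally show ?thesis unfolding k' rw by (simp add: power_numeral_reduce power2_eq_square algebra_simps)
qed

section \<open>The affine normal as a function of t, and the symmetry\<close>

text \<open>In \<open>\<phi>_power5\<close> all other quantities depend on t alone, and the fifth
  power is injective on the reals.\<close>

lemma \<phi>_eq:
  assumes "p \<in> M" "q \<in> M" "p $ 1 = q $ 1"
  shows "\<phi> p = \<phi> q"
proof -
  have "\<phi> p ^ 5 * ((a (q $ 1))\<^sup>2 * (D a (q $ 1))\<^sup>2) = \<phi> q ^ 5 * ((a (q $ 1))\<^sup>2 * (D a (q $ 1))\<^sup>2)"
    using \<phi>_power5[OF assms(1)] \<phi>_power5[OF assms(2)] assms(3) by (simp add: mult.assoc)
  then have "\<phi> p ^ 5 = \<phi> q ^ 5"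
    using a_nz[OF assms(2)] Da_nz[OF assms(2)] by simp
  then have "root 5 (\<phi> p ^ 5) = root 5 (\<phi> q ^ 5)" by simp
  then show ?thesis by (simp add: odd_real_root_power_cancel)
qed

lemma smooth_\<phi>: "smooth_on M \<phi>"
proof -
  have nz: "D a (p $ 1) \<noteq> 0" if "p \<in> M" for p by (rule Da_nz[OF that])
  have nth: "smooth_on M (\<lambda>p. p $ i)" for i by (rule smooth_on_linear[OF openM bounded_linear_vec_nth])
  note r = smooth_on_diff[OF openM] smooth_on_add[OF openM] smooth_on_mult[OF openM]
    smooth_on_divide[OF openM _ _ nz] smooth_on_nth[OF openM smooth_\<xi>] nth
    smooth_q[OF smooth_on_frechet_derivative[OF f]] smooth_q[OF f] smooth_t[OF smooth_D[OF smooth_a]] smooth_t[OF smooth_D[OF smooth_b]]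
  show ?thesis
    unfolding \<phi>_def[abs_def] \<nu>_def by (rule r | assumption)+
qed

lemma pointwise_Z3: "pointwise_Z3_symmetry M F \<xi>"
proof (cases "M = {}")
  case True
  then show ?thesis by (simp add: pointwise_Z3_symmetry_def pointwise_symmetry_def)
next
  case False
  then obtain p0 where p0: "p0 \<in> M" by blast
  \<comment> \<open>\<open>c\<close> reads \<phi> on the t-line over the plane point of
    \<open>p0\<close>. By \<open>\<phi>_eq\<close> it determines \<phi>, and it inherits
    smoothness.\<close>
  define c where "c t = \<phi> (vector [0, p0 $ 2, p0 $ 3] + t *\<^sub>R axis 1 1)" for t
  have slice: "vector [0, p0 $ 2, p0 $ 3] + t *\<^sub>R axis 1 1 \<in> M"
      "(vector [0, p0 $ 2, p0 $ 3] + t *\<^sub>R axis 1 1 :: real^3) $ 1 = t" if "t \<in> I" for t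
  proof -
    have "plane (vector [0, p0 $ 2, p0 $ 3] + t *\<^sub>R axis 1 1) = plane p0"
      by (simp add: vec_eq_iff forall_2 axis_def)
    then show "vector [0, p0 $ 2, p0 $ 3] + t *\<^sub>R axis 1 1 \<in> M"
      using M_N[OF p0] that by (simp add: M_eq axis_def)
    show "(vector [0, p0 $ 2, p0 $ 3] + t *\<^sub>R axis 1 1 :: real^3) $ 1 = t" by (simp add: axis_def)
  qed
  have \<phi>: "\<phi> p = c (p $ 1)" if "p \<in> M" for p
    unfolding c_def using slice[OF M_I[OF that]] by (intro \<phi>_eq that) simp_all
  have smooth_c: "smooth_on I c"
    unfolding c_def[abs_def]
    by (rule smooth_on_affine[OF openM openI bounded_linear_scaleR_left slice(1) smooth_\<phi>])
  have c_nz: "c t \<noteq> 0" and Da_nz': "D a t \<noteq> 0" and lam_c: "lam t / c t > 0" if "t \<in> I" for t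
    using \<phi>_nz[OF slice(1)[OF that]] Da_nz[OF slice(1)[OF that]] lam_pos[OF slice(1)[OF that]] slice(2)[OF that]
    unfolding c_def by simp_all
  have smooth_lam: "smooth_on I lam"
    unfolding lam_def[abs_def]
    by (intro smooth_on_diff smooth_on_divide smooth_on_mult openI smooth_D smooth_a smooth_b Da_nz')
  \<comment> \<open>The value that the t-derivative of \<phi> forces on the fourth entry of \<xi>,
    found from \<open>key\<close> at \<partial>_t.\<close>
  define \<kappa> where "\<kappa> t = - (D c t * D a t / lam t)" for t
  have lam_nz: "lam t \<noteq> 0" if "t \<in> I" for t using lam_c[OF that] by auto
  have smooth_\<kappa>: "smooth_on I \<kappa>"
    unfolding \<kappa>_def[abs_def]
    by (intro smooth_on_minus smooth_on_divide smooth_on_mult openI smooth_D smooth_a smooth_c smooth_lam lam_nz)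
  have D\<xi>: "((\<lambda>q. \<xi> q $ i) has_derivative (\<lambda>x. dir_deriv \<xi> p x $ i)) (at p)" if "p \<in> M" for p i
    unfolding dir_deriv_def
    by (rule bounded_linear.has_derivative[OF bounded_linear_vec_nth smooth_on_has_derivative[OF smooth_\<xi> that]])
  have \<nu>_D\<xi>: "\<nu> p (dir_deriv \<xi> p x) = 0" if "p \<in> M" for p x
  proof -
    have "dir_deriv \<xi> p x \<in> range (dir_deriv F p)"
      using hyp that by (simp add: affine_hypersurface_def affine_normal_def)
    then show ?thesis using \<nu>_dir_deriv[OF that] by auto
  qed
  \<comment> \<open>\<phi> = \<nu>(\<xi>) is differentiated. The term \<nu>(D\<xi>) vanishes because
    D\<xi> is tangential. What remains comes from varying the conormal: the Hessian from the
    derivative of df, and \<lambda>/a' from b'/a'; the other terms cancel.\<close>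
  have key: "D c (p $ 1) * x $ 1 = - hess f (plane p) (vector [\<xi> p $ 1 - p $ 2 * \<xi> p $ 4, \<xi> p $ 2 - p $ 3 * \<xi> p $ 4]) (plane x)
      - lam (p $ 1) / D a (p $ 1) * x $ 1 * \<xi> p $ 4" if p: "p \<in> M" for p x
  proof -
    define V :: "real^2" where "V = vector [\<xi> p $ 1 - p $ 2 * \<xi> p $ 4, \<xi> p $ 2 - p $ 3 * \<xi> p $ 4]"
    note Q = has_derivative_q[OF f p] has_derivative_q[OF smooth_on_frechet_derivative[OF f] p]
    note A1 = has_derivative_t[OF smooth_D[OF smooth_a] p] and B1 = has_derivative_t[OF smooth_D[OF smooth_b] p]
    have V: "hess f (plane p) V y = V $ 1 * hess f (plane p) (axis 1 1) y + V $ 2 * hess f (plane p) (axis 2 1) y" for y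
      by (subst vec2_eq[of V]) (simp add: symmetric_formD(2-5)[OF hess_symmetric_form[OF openN f M_N[OF p]]])
    have quot: "(D (D b) (p $ 1) * r * D a (p $ 1) - D b (p $ 1) * (D (D a) (p $ 1) * r)) / (D a (p $ 1) * D a (p $ 1))
        = lam (p $ 1) / D a (p $ 1) * r" for r
      using Da_nz[OF p] by (simp add: lam_def field_simps)
    have "(\<phi> has_derivative (\<lambda>x. \<nu> p (dir_deriv \<xi> p x) - hess f (plane p) V (plane x)
        - lam (p $ 1) / D a (p $ 1) * x $ 1 * \<xi> p $ 4)) (at p)"
      unfolding \<phi>_def[abs_def] \<nu>_def V
      by (rule has_derivative_eq_rhs[OF has_derivative_diff[OF has_derivative_diff[OF has_derivative_diff[OF D\<xi>[OF p]
                has_derivative_mult[OF has_derivative_diff[OF D\<xi>[OF p] has_derivative_mult[OF has_derivative_nth D\<xi>[OF p]]] Q(2)]]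
              has_derivative_mult[OF has_derivative_diff[OF D\<xi>[OF p] has_derivative_mult[OF has_derivative_nth D\<xi>[OF p]]] Q(2)]]
            has_derivative_mult[OF has_derivative_add[OF Q(1) has_derivative_divide'[OF B1 A1 Da_nz[OF p]]] D\<xi>[OF p]]]])
        (rule ext, unfold quot, simp add: hess_def V_def linear_plane_coordinates[OF linear_df[OF p], of "plane _"] algebra_simps)
    moreover have "(\<phi> has_derivative (\<lambda>x. D c (p $ 1) * x $ 1)) (at p)"
      by (rule has_derivative_transform_within_open[OF has_derivative_t[OF smooth_c p] openM p]) (simp add: \<phi>)
    ultimately have "(\<lambda>x. \<nu> p (dir_deriv \<xi> p x) - hess f (plane p) V (plane x)
        - lam (p $ 1) / D a (p $ 1) * x $ 1 * \<xi> p $ 4) = (\<lambda>x. D c (p $ 1) * x $ 1)"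
      by (rule has_derivative_unique)
    from fun_cong[OF this, of x] show ?thesis by (simp add: \<nu>_D\<xi>[OF p] V_def)
  qed
  \<comment> \<open>At \<partial>_t, \<open>key\<close> gives the fourth entry. On the plane it says
    that \<open>V\<close> lies in the kernel of the Hessian, which has determinant 1, so
    \<open>V\<close> vanishes.\<close>
  have \<xi>: "\<xi> p $ 4 = \<kappa> (p $ 1)" "\<xi> p $ 1 = p $ 2 * \<kappa> (p $ 1)" "\<xi> p $ 2 = p $ 3 * \<kappa> (p $ 1)" if p: "p \<in> M" for p
  proof -
    define V :: "real^2" where "V = vector [\<xi> p $ 1 - p $ 2 * \<xi> p $ 4, \<xi> p $ 2 - p $ 3 * \<xi> p $ 4]"
    note form = symmetric_formD[OF hess_symmetric_form[OF openN f M_N[OF p]]]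
    have "plane (axis 1 1) = 0" by (simp add: vec_eq_iff forall_2 axis_def)
    then have "D c (p $ 1) = - (lam (p $ 1) / D a (p $ 1) * \<xi> p $ 4)"
      using key[OF p, of "axis 1 1"] form(11) by (simp add: axis_def)
    then show 4: "\<xi> p $ 4 = \<kappa> (p $ 1)"
      using lam_nz[OF M_I[OF p]] Da_nz[OF p] by (simp add: \<kappa>_def)
    have V: "hess f (plane p) V (plane x) = 0" if "x $ 1 = 0" for x
      using key[OF p, of x] that by (simp add: V_def)
    note hc = hess_coordinates[OF openN f M_N[OF p]]
    have "hess f (plane p) V (axis 1 1) = 0" "hess f (plane p) V (axis 2 1) = 0"
      using V[of "vector [0, 1, 0]"] V[of "vector [0, 0, 1]"]
      by (simp_all add: hc[of V] axis_def)
    then have "V $ 1 = 0 \<and> V $ 2 = 0"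
      using hess_pos(2)[OF p] unfolding hess_det_def hc[of V]
      by (simp add: axis_def) algebra
    then show "\<xi> p $ 1 = p $ 2 * \<kappa> (p $ 1)" "\<xi> p $ 2 = p $ 3 * \<kappa> (p $ 1)"
      by (simp_all add: V_def 4)
  qed
  \<comment> \<open>\<open>tang\<close> reads the entries 1, 2 and 4 of the derivative, exactly
    those made explicit in \<open>\<xi>\<close>.\<close>
  have shape: "shape_operator F \<xi> p x = (- (\<kappa> (p $ 1) / a (p $ 1))) *\<^sub>R x
      + ((\<kappa> (p $ 1) / a (p $ 1) - D \<kappa> (p $ 1) / D a (p $ 1)) * x $ 1) *\<^sub>R axis 1 1" if p: "p \<in> M" for p x
  proof -
    have eq: "dir_deriv \<xi> p x $ i = G' x" if "(G has_derivative G') (at p)" "\<And>q. q \<in> M \<Longrightarrow> G q = \<xi> q $ i" for i G G'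
    proof -
      have "((\<lambda>q. \<xi> q $ i) has_derivative G') (at p)"
        by (rule has_derivative_transform_within_open[OF that(1) openM p that(2)])
      then show ?thesis using has_derivative_unique[OF D\<xi>[OF p]] by metis
    qed
    note K = has_derivative_t[OF smooth_\<kappa> p]
    have "dir_deriv \<xi> p x $ 4 = D \<kappa> (p $ 1) * x $ 1"
      by (rule eq[OF K]) (simp add: \<xi>)
    moreover have "dir_deriv \<xi> p x $ 1 = p $ 2 * (D \<kappa> (p $ 1) * x $ 1) + x $ 2 * \<kappa> (p $ 1)"
      by (rule eq[OF has_derivative_mult[OF has_derivative_nth K]]) (simp add: \<xi>)
    moreover have "dir_deriv \<xi> p x $ 2 = p $ 3 * (D \<kappa> (p $ 1) * x $ 1) + x $ 3 * \<kappa> (p $ 1)"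
      by (rule eq[OF has_derivative_mult[OF has_derivative_nth K]]) (simp add: \<xi>)
    ultimately show ?thesis
      unfolding shape_operator_def parts[OF p] \<nu>_D\<xi>[OF p] tang_def vec_eq_iff forall_3
      by (simp add: axis_def algebra_simps add_divide_distrib)
  qed
  \<comment> \<open>The shape required by \<open>Z3_symmetry_at\<close>. The summand -2 a'/a
    compensates the first coordinate of the symmetric last term.\<close>
  have conn: "induced_connection F \<xi> (\<lambda>_. x) (\<lambda>_. y) p =
      ((D (D a) (p $ 1) / D a (p $ 1) - 2 * (D a (p $ 1) / a (p $ 1))) * x $ 1 * y $ 1
        - \<kappa> (p $ 1) / D a (p $ 1) * h p x y) *\<^sub>R axis 1 1
      + (D a (p $ 1) / a (p $ 1)) *\<^sub>R (x $ 1 *\<^sub>R y + y $ 1 *\<^sub>R x)" if p: "p \<in> M" for p x y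
  proof -
    have "tang p (\<xi> p) = (\<kappa> (p $ 1) / D a (p $ 1)) *\<^sub>R axis 1 1"
      by (simp add: tang_def \<xi>[OF p] vec_eq_iff forall_3 axis_def)
    moreover have "tang p (dir_deriv (\<lambda>q. dir_deriv F q y) p x) =
        ((D (D a) (p $ 1) / D a (p $ 1) - 2 * (D a (p $ 1) / a (p $ 1))) * x $ 1 * y $ 1) *\<^sub>R axis 1 1
        + (D a (p $ 1) / a (p $ 1)) *\<^sub>R (x $ 1 *\<^sub>R y + y $ 1 *\<^sub>R x)"
      unfolding second_derivative_F[OF p] tang_def vec_eq_iff forall_3
      by (simp add: axis_def algebra_simps add_divide_distrib)
    ultimately show ?thesis
      unfolding induced_connection_def parts[OF p] affine_metric_def
      by (simp add: algebra_simps)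
  qed
  \<comment> \<open>Every pair (t, q) comes from a point of \<open>M\<close>, which carries facts at
    points of \<open>M\<close> over to \<open>I\<close> and \<open>N\<close>.\<close>
  have N_M: "plane (vector [t, q $ 1, q $ 2]) = q" "t \<in> I \<Longrightarrow> q \<in> N \<Longrightarrow> vector [t, q $ 1, q $ 2] \<in> M" for t q
  proof -
    show "plane (vector [t, q $ 1, q $ 2]) = q" by (simp add: vec_eq_iff forall_2)
    then show "t \<in> I \<Longrightarrow> q \<in> N \<Longrightarrow> vector [t, q $ 1, q $ 2] \<in> M" by (simp add: M_eq)
  qed
  interpret warped_hessian I N M f "\<lambda>t. lam t / c t" "\<lambda>t. a t / c t" h
  proof
    show "smooth_on N f" by (rule f)
    show "smooth_on I (\<lambda>t. lam t / c t)" "smooth_on I (\<lambda>t. a t / c t)"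
      by (intro smooth_on_divide openI smooth_lam smooth_a smooth_c c_nz; assumption)+
    show "lam t / c t > 0" if "t \<in> I" for t by (rule lam_c[OF that])
    show "a t / c t * hess f q (axis 1 1) (axis 1 1) > 0" if "t \<in> I" "q \<in> N" for t q
      using hess_pos(1)[OF N_M(2)[OF that]] \<phi>[OF N_M(2)[OF that]] by (simp add: N_M(1))
    show "hess_det f q = 1" if "q \<in> N" for q
      using hess_pos(2)[OF N_M(2)[OF M_I[OF p0] that]] by (simp add: N_M(1))
    show "h p x y = lam (p $ 1) / c (p $ 1) * x $ 1 * y $ 1 + a (p $ 1) / c (p $ 1) * hess f (plane p) (plane x) (plane y)"
      if "p \<in> M" for p x y
      by (simp add: metric[OF that] \<phi>[OF that] add_divide_distrib)
  qed
  show ?thesis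
    unfolding pointwise_Z3_symmetry_def pointwise_symmetry_def difference_tensor_def
    using Z3_symmetry_at[OF _ conn shape] by blast
qed

end

theorem theorem4p4:
  fixes I :: "real set" and N :: "(real^2) set" and f :: "real^2 \<Rightarrow> real"
    and \<psi> :: "real^2 \<Rightarrow> real^3" and \<gamma> :: "real \<Rightarrow> real^2"
    and M :: "(real^3) set" and F :: "real^3 \<Rightarrow> real^4" and \<xi> :: "real^3 \<Rightarrow> real^4"
  assumes "\<psi> = (\<lambda>q. vector [q $ 1, q $ 2, f q])"
    and "improper_affine_sphere N \<psi> (\<lambda>q. vector [0, 0, 1])"
    and "open I" and "is_interval I"
    and "smooth_on I \<gamma>"
    and "M = {p. p $ 1 \<in> I \<and> vector [p $ 2, p $ 3] \<in> N}"
    and "F = (\<lambda>p. let t = p $ 1; u = p $ 2; v = p $ 3 in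
           vector [(\<gamma> t $ 1) * u, (\<gamma> t $ 1) * v, (\<gamma> t $ 1) * f (vector [u, v]) + \<gamma> t $ 2, \<gamma> t $ 1])"
    and "affine_hypersurface M F \<xi>"
    and "positive_definite_on M (affine_metric F \<xi>)"
  shows "pointwise_Z3_symmetry M F \<xi> \<or> pointwise_SO2_symmetry M F \<xi>"
proof -
  have sphere: "improper_affine_sphere N (\<lambda>q. vector [q $ 1, q $ 2, f q]) (\<lambda>q. vector [0, 0, 1])"
    using assms(1,2) by simp
  interpret cone_hypersurface I N M f \<gamma> F \<xi>
  proof
    show "open N" using sphere
      by (simp add: improper_affine_sphere_def affine_hypersurface_def immersion_on_def)
    show "open M" using assms(8) by (simp add: affine_hypersurface_def immersion_on_def)
  qed (use assms sphere in \<open>simp_all add: plane_def Let_def\<close>)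
  show ?thesis using pointwise_Z3 by blast
qed

end
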